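(* Let $n\ge 0$ be an integer and let $D$ be a flat virtual knot diagram with a fixed nonempty vertex set $V=V_{flat}\cup V_{fake}$. Let $A$ and $B$ be the $k\times k$ coloring matrices over $\mathcal{S}_n$ of $(D,V)$ obtained from two choices of starting arc. Then there exist units $U,W\in\mathcal{S}_n$ with $\pi_{0,n}(UW)=1$ such that $|B|_{k,k}=U\,|A|_{k,k}\,W$. That is, for fixed $(D,V)$, the $\mathcal{S}_n$-coloring invariant is independent of the choice of the starting arc.
   Context: Ring. For a non-negative integer $n$, $\mathcal{S}_n$ is the unital ring $\mathbb{Z}\langle s,\overline{s},t\rangle/I_n$, where $I_n$ is the two-sided ideal generated by $s\overline{s}-1$, $\overline{s}s-1$, $ts-s\sum_{i=1}^{n}t^{i}$, $t\overline{s}-\overline{s}\sum_{i=1}^{n}(-1)^{i-1}t^{i}$ and $t^{n+1}$; the image of $\overline{s}$ is written $s^{-1}$. $\mathcal{S}_0=\mathbb{Z}[s^{\pm1}]$, and $\pi_{0,n}:\mathcal{S}_n\to\mathcal{S}_0$ is the ring homomorphism with $s\mapsto s$, $t\mapsto 0$. Quasideterminant. For an $m\times m$ matrix $A$ over a ring, let $A^{i,j}$ be $A$ with row $i$ and column $j$ deleted, $r_i^{j}(A)$ the $i$-th row with its $j$-th entry deleted, $c^{i}_{j}(A)$ the $j$-th column with its $i$-th entry deleted. If $m=1$, $|A|_{1,1}=(A)_{1,1}$. If $m>1$ and $A^{i,j}$ is invertible, $|A|_{i,j}=(A)_{i,j}-r_i^{j}(A)(A^{i,j})^{-1}c^{i}_{j}(A)$.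 For the coloring matrices below, $|A|_{k,k}$ is always defined. Diagrams. A flat virtual knot diagram is a generic immersion of an oriented circle $S^1$ into $\mathbb{R}^2$ (finitely many multiple points, all transversal double points), each double point being labeled "flat" or "virtual". $V_{flat}$ is the set of flat crossings, and $V_{fake}$ is a (possibly empty) finite set of points of the image that are not double points, called fake vertices; $V=V_{flat}\cup V_{fake}$ is assumed nonempty. The preimage of $V$ cuts $S^1$ into $k$ components, whose images are called the arcs of $(D,V)$ (virtual crossings do not cut arcs). Coloring matrix. Choose a starting arc, label it $1$, and label the other arcs $2,\dots,k$ in order along the orientation; the arc with index $0$ means arc $k$. Let $e_1,\dots,e_k$ be the standard row vectors. At each flat crossing with velocity vectors of its two strands $v_1,v_2$, name the strands so that $(v_1,v_2)$ is a positively oriented basis of $\mathbb{R}^2$. The $i$-th row of $A$ is determined by the vertex at the initial point of arc $i$: (a) if it is a flat crossing and arcs $i-1,i$ lie (before and after the crossing) on its strand 2, the row is $e_i-s\,e_{i-1}-t\,e_j$, where $j$ is the label of the arc entering the crossing along strand 1; (b) if it is a flat crossing and arcs $i-1,i$ lie on its strand 1, the row is $e_i-s^{-1}(1-t^2)\,e_{i-1}+s^{-1}ts\,e_j$, where $j$ is the label of the arc entering the crossing along strand 2; (c) if it is a fake vertex, the row is $e_i-e_{i-1}$ (zero if $k=1$). Coefficients are added when indices coincide. The $\mathcal{S}_n$-coloring invariant is the class of $|A|_{k,k}$ under the equivalence relation $F\sim UFW$ for units $U,W\in\mathcal{S}_n$ with $\pi_{0,n}(UW)=1$. *)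

theory Defs
  imports
    "HOL-Analysis.Analysis"
    "HOL-Algebra.QuotRing"
    "HOL-Library.Poly_Mapping"
begin

section \<open>The rings \<open>S\<^sub>n\<close>\<close>

datatype gen = Gs | Gsbar | Gt

text \<open>The free monoid on the three generators, written additively so that finitely supported
  integer functions on it, with the convolution product of \<^theory>\<open>HOL-Library.Poly_Mapping\<close>,
  form the free unital ring on three generators.\<close>

datatype word = Word "gen list"

instantiation word :: monoid_add
begin

definition zero_word :: word where "0 = Word []"

fun plus_word :: "word \<Rightarrow> word \<Rightarrow> word" where
  "Word u + Word v = Word (u @ v)"

instance
proof
  fix a b c :: word
  show "a + b + c = a + (b + c)" by (cases a; cases b; cases c) simp
  show "0 + a = a" by (cases a) (simp add: zero_word_def)
  show "a + 0 = a" by (cases a) (simp add: zero_word_def)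
qed

end

type_synonym free = "word \<Rightarrow>\<^sub>0 int"

definition gen :: "gen \<Rightarrow> free" where
  "gen g = Poly_Mapping.single (Word [g]) 1"

definition free_ring :: "free ring" where
  "free_ring = \<lparr>carrier = UNIV, mult = (*), one = 1, zero = 0, add = (+)\<rparr>"

definition S_relators :: "nat \<Rightarrow> free set" where
  "S_relators n =
    (let s = gen Gs; s' = gen Gsbar; t = gen Gt in
      {s * s' - 1,
       s' * s - 1,
       t * s - s * (\<Sum>i=1..n. t ^ i),
       t * s' - s' * (\<Sum>i=1..n. (- 1) ^ (i - 1) * t ^ i),
       t ^ (n + 1)})"

definition S_ideal :: "nat \<Rightarrow> free set" where
  "S_ideal n = genideal free_ring (S_relators n)"

definition S_ring :: "nat \<Rightarrow> free set ring" where
  "S_ring n = free_ring Quot (S_ideal n)"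

definition S_class :: "nat \<Rightarrow> free \<Rightarrow> free set" where
  "S_class n x = S_ideal n +>\<^bsub>free_ring\<^esub> x"

definition S_s :: "nat \<Rightarrow> free set" where "S_s n = S_class n (gen Gs)"
definition S_sinv :: "nat \<Rightarrow> free set" where "S_sinv n = S_class n (gen Gsbar)"
definition S_t :: "nat \<Rightarrow> free set" where "S_t n = S_class n (gen Gt)"

text \<open>The ideal of \<open>S\<^sub>n\<close> is contained in that of \<open>S\<^sub>0\<close>, so the ring homomorphism
  \<open>\<pi>\<^sub>0\<^sub>,\<^sub>n\<close> with \<open>s \<mapsto> s\<close> and \<open>t \<mapsto> 0\<close> is induced by the identity of the free ring: the coset
  \<open>X\<close> is sent to the coset \<open>I\<^sub>0 + X\<close>. The lemmas below confirm the characterising properties.\<close>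

definition S_pi0 :: "nat \<Rightarrow> free set \<Rightarrow> free set" where
  "S_pi0 n X = S_ideal 0 <+>\<^bsub>free_ring\<^esub> X"

lemma free_ring_simps [simp]:
  "carrier free_ring = UNIV" "x \<otimes>\<^bsub>free_ring\<^esub> y = x * y" "\<one>\<^bsub>free_ring\<^esub> = 1"
  "\<zero>\<^bsub>free_ring\<^esub> = 0" "x \<oplus>\<^bsub>free_ring\<^esub> y = x + y"
  by (simp_all add: free_ring_def)

lemma ring_free_ring: "ring free_ring"
proof (rule ringI)
  show "abelian_group free_ring"
    by (rule abelian_groupI) (auto simp: algebra_simps intro: exI[of _ "- _"])
  show "monoid free_ring"
    by (rule monoidI) (auto simp: algebra_simps)
qed (auto simp: algebra_simps)

lemma ideal_S_ideal: "ideal (S_ideal n) free_ring"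
  unfolding S_ideal_def by (rule ring.genideal_ideal[OF ring_free_ring]) simp

lemma ring_S_ring: "ring (S_ring n)"
  unfolding S_ring_def by (rule ideal.quotient_is_ring[OF ideal_S_ideal])

lemma S_class_hom: "S_class n \<in> ring_hom free_ring (S_ring n)"
  using ideal.rcos_ring_hom[OF ideal_S_ideal, of n]
  by (simp add: S_class_def[abs_def] S_ring_def)

lemma S_class_eq: "S_class n x = {i + x | i. i \<in> S_ideal n}"
  by (auto simp: S_class_def a_r_coset_def')

lemma S_ideal_closed:
  "0 \<in> S_ideal n"
  "x \<in> S_ideal n \<Longrightarrow> y \<in> S_ideal n \<Longrightarrow> x + y \<in> S_ideal n"
  "x \<in> S_ideal n \<Longrightarrow> y * x \<in> S_ideal n"
  "x \<in> S_ideal n \<Longrightarrow> x * y \<in> S_ideal n"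
  using additive_subgroup.zero_closed[OF ideal.axioms(1)[OF ideal_S_ideal, of n]]
    additive_subgroup.a_closed[OF ideal.axioms(1)[OF ideal_S_ideal, of n], of x y]
    ideal.I_l_closed[OF ideal_S_ideal, of x n y] ideal.I_r_closed[OF ideal_S_ideal, of x n y]
  by simp_all

lemma S_ideal_diff: "x \<in> S_ideal n \<Longrightarrow> y \<in> S_ideal n \<Longrightarrow> x - y \<in> S_ideal n"
  using S_ideal_closed(2)[of x n "(- 1) * y"] S_ideal_closed(3)[of y n "- 1"] by simp

lemma S_relators_subset: "S_relators n \<subseteq> S_ideal n"
  unfolding S_ideal_def by (rule ring.genideal_self[OF ring_free_ring]) simp

lemma gen_Gt_S_ideal0: "gen Gt \<in> S_ideal 0"
  using S_relators_subset[of 0] by (simp add: S_relators_def Let_def)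

lemma S_ideal_subset: "S_ideal n \<subseteq> S_ideal 0"
proof -
  have pow: "gen Gt ^ i \<in> S_ideal 0" if i: "i \<ge> 1" for i
  proof -
    obtain j where "i = Suc j" using i by (cases i) auto
    then show ?thesis using S_ideal_closed(4)[OF gen_Gt_S_ideal0] by simp
  qed
  have sum: "(\<Sum>i\<in>J. f i) \<in> S_ideal 0" if "\<And>i. i \<in> J \<Longrightarrow> f i \<in> S_ideal 0"
    for J :: "nat set" and f
    using that by (induction J rule: infinite_finite_induct) (auto intro: S_ideal_closed)
  have "S_relators n \<subseteq> S_ideal 0"
    using S_relators_subset[of 0]
    by (auto simp: S_relators_def Let_def simp del: power_Suc intro!: S_ideal_diff sum pow
        S_ideal_closed(3)[of "sum _ _"] S_ideal_closed(3)[of "gen Gt ^ _"]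
        S_ideal_closed(4)[OF gen_Gt_S_ideal0])
  then show ?thesis
    unfolding S_ideal_def[of n] by (rule ring.genideal_minimal[OF ring_free_ring ideal_S_ideal])
qed

lemma S_pi0_class: "S_pi0 n (S_class n x) = S_class 0 x"
proof -
  have "S_pi0 n (S_class n x) = {i + (j + x) | i j. i \<in> S_ideal 0 \<and> j \<in> S_ideal n}"
    by (auto simp: S_pi0_def S_class_eq set_add_def')
  also have "\<dots> = {i + x | i. i \<in> S_ideal 0}"
  proof (intro equalityI subsetI)
    fix y assume "y \<in> {i + (j + x) | i j. i \<in> S_ideal 0 \<and> j \<in> S_ideal n}"
    then obtain i j where "i \<in> S_ideal 0" "j \<in> S_ideal n" "y = (i + j) + x"
      by (auto simp: add.assoc)
    then show "y \<in> {i + x | i. i \<in> S_ideal 0}"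
      using S_ideal_subset[of n] S_ideal_closed(2) by blast
  next
    fix y assume "y \<in> {i + x | i. i \<in> S_ideal 0}"
    then show "y \<in> {i + (j + x) | i j. i \<in> S_ideal 0 \<and> j \<in> S_ideal n}"
      using S_ideal_closed(1)[of n] by force
  qed
  finally show ?thesis by (simp add: S_class_eq)
qed

lemma carrier_S_ring: "carrier (S_ring n) = range (S_class n)"
  by (auto simp: S_ring_def S_class_def FactRing_def A_RCOSETS_def')

lemma S_pi0_hom: "S_pi0 n \<in> ring_hom (S_ring n) (S_ring 0)"
proof (rule ring_hom_memI)
  note h = ring_hom_mult[OF S_class_hom, simplified, symmetric]
    ring_hom_add[OF S_class_hom, simplified, symmetric]
    ring_hom_one[OF S_class_hom, simplified, symmetric]
  show "S_pi0 n x \<in> carrier (S_ring 0)" if "x \<in> carrier (S_ring n)" for x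
    using that by (auto simp: carrier_S_ring S_pi0_class)
  show "S_pi0 n (x \<otimes>\<^bsub>S_ring n\<^esub> y) = S_pi0 n x \<otimes>\<^bsub>S_ring 0\<^esub> S_pi0 n y"
    if "x \<in> carrier (S_ring n)" "y \<in> carrier (S_ring n)" for x y
    using that by (auto simp: carrier_S_ring S_pi0_class h)
  show "S_pi0 n (x \<oplus>\<^bsub>S_ring n\<^esub> y) = S_pi0 n x \<oplus>\<^bsub>S_ring 0\<^esub> S_pi0 n y"
    if "x \<in> carrier (S_ring n)" "y \<in> carrier (S_ring n)" for x y
    using that by (auto simp: carrier_S_ring S_pi0_class h)
  show "S_pi0 n \<one>\<^bsub>S_ring n\<^esub> = \<one>\<^bsub>S_ring 0\<^esub>"
    by (simp add: S_pi0_class h)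
qed

lemma S_pi0_gens:
  "S_pi0 n (S_s n) = S_s 0" "S_pi0 n (S_sinv n) = S_sinv 0" "S_pi0 n (S_t n) = \<zero>\<^bsub>S_ring 0\<^esub>"
proof -
  show "S_pi0 n (S_s n) = S_s 0" "S_pi0 n (S_sinv n) = S_sinv 0"
    by (simp_all add: S_s_def S_sinv_def S_pi0_class)
  have "S_class 0 (gen Gt) = S_ideal 0"
    unfolding S_class_def
    by (rule abelian_subgroup.a_rcos_const[OF ideal.axioms(1)[OF ideal_S_ideal, THEN
          abelian_subgroupI3, OF ring.is_abelian_group[OF ring_free_ring]] gen_Gt_S_ideal0])
  then show "S_pi0 n (S_t n) = \<zero>\<^bsub>S_ring 0\<^esub>"
    by (simp add: S_t_def S_pi0_class S_ring_def FactRing_simps)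
qed


section \<open>Quasideterminants\<close>

text \<open>An \<open>m \<times> m\<close> matrix is a function on \<open>{1..m} \<times> {1..m}\<close>. Deleting row \<open>i\<close> and column \<open>j\<close> is
  restricting to the index sets \<open>{1..m} - {i}\<close> and \<open>{1..m} - {j}\<close>; the inverse of a matrix with
  rows \<open>I\<close> and columns \<open>J\<close> has rows \<open>J\<close> and columns \<open>I\<close>.\<close>

definition is_mat_inverse ::
  "('r, 'x) ring_scheme \<Rightarrow> nat set \<Rightarrow> nat set \<Rightarrow> (nat \<Rightarrow> nat \<Rightarrow> 'r) \<Rightarrow> (nat \<Rightarrow> nat \<Rightarrow> 'r) \<Rightarrow> bool"
where
  "is_mat_inverse R I J A C \<longleftrightarrow>
    (\<forall>j\<in>J. \<forall>i\<in>I. C j i \<in> carrier R) \<and>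
    (\<forall>i\<in>I. \<forall>i'\<in>I. (\<Oplus>\<^bsub>R\<^esub>j\<in>J. A i j \<otimes>\<^bsub>R\<^esub> C j i') = (if i = i' then \<one>\<^bsub>R\<^esub> else \<zero>\<^bsub>R\<^esub>)) \<and>
    (\<forall>j\<in>J. \<forall>j'\<in>J. (\<Oplus>\<^bsub>R\<^esub>i\<in>I. C j i \<otimes>\<^bsub>R\<^esub> A i j') = (if j = j' then \<one>\<^bsub>R\<^esub> else \<zero>\<^bsub>R\<^esub>))"

definition quasidet_defined ::
  "('r, 'x) ring_scheme \<Rightarrow> nat \<Rightarrow> (nat \<Rightarrow> nat \<Rightarrow> 'r) \<Rightarrow> nat \<Rightarrow> nat \<Rightarrow> bool"
where
  "quasidet_defined R m A i j \<longleftrightarrow>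
    m = 1 \<or> (\<exists>C. is_mat_inverse R ({1..m} - {i}) ({1..m} - {j}) A C)"

definition quasidet ::
  "('r, 'x) ring_scheme \<Rightarrow> nat \<Rightarrow> (nat \<Rightarrow> nat \<Rightarrow> 'r) \<Rightarrow> nat \<Rightarrow> nat \<Rightarrow> 'r"
where
  "quasidet R m A i j =
    (if m = 1 then A i j
     else let I = {1..m} - {i}; J = {1..m} - {j}; C = (SOME C. is_mat_inverse R I J A C)
       in A i j \<ominus>\<^bsub>R\<^esub> (\<Oplus>\<^bsub>R\<^esub>q\<in>J. \<Oplus>\<^bsub>R\<^esub>p\<in>I. A i q \<otimes>\<^bsub>R\<^esub> C q p \<otimes>\<^bsub>R\<^esub> A p j))"


section \<open>Flat virtual knot diagrams\<close>

text \<open>The oriented circle is \<open>\<real>/\<int>\<close>, so a closed curve is a 1-periodic function on the reals, and two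
  parameters give the same point of the circle iff their difference is an integer.\<close>

definition velocity :: "(real \<Rightarrow> real^2) \<Rightarrow> real \<Rightarrow> real^2" where
  "velocity \<gamma> \<theta> = vector_derivative \<gamma> (at \<theta>)"

definition immersed_circle :: "(real \<Rightarrow> real^2) \<Rightarrow> bool" where
  "immersed_circle \<gamma> \<longleftrightarrow>
    (\<forall>\<theta>. \<gamma> (\<theta> + 1) = \<gamma> \<theta>) \<and> \<gamma> C1_differentiable_on UNIV \<and> (\<forall>\<theta>. velocity \<gamma> \<theta> \<noteq> 0)"

definition multiple_points :: "(real \<Rightarrow> real^2) \<Rightarrow> (real^2) set" where
  "multiple_points \<gamma> = {x. \<exists>\<theta> \<theta>'. \<theta> - \<theta>' \<notin> \<int> \<and> \<gamma> \<theta> = x \<and> \<gamma> \<theta>' = x}"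

definition positively_oriented :: "real^2 \<Rightarrow> real^2 \<Rightarrow> bool" where
  "positively_oriented v w \<longleftrightarrow> det (vector [v, w] :: real^2^2) > 0"

definition generic_immersion :: "(real \<Rightarrow> real^2) \<Rightarrow> bool" where
  "generic_immersion \<gamma> \<longleftrightarrow>
    immersed_circle \<gamma> \<and>
    finite (multiple_points \<gamma>) \<and>
    (\<forall>x\<in>multiple_points \<gamma>. card {\<theta>\<in>{0..<1}. \<gamma> \<theta> = x} = 2) \<and>
    (\<forall>\<theta> \<theta>'. \<gamma> \<theta> = \<gamma> \<theta>' \<and> \<theta> - \<theta>' \<notin> \<int> \<longrightarrow>
      det (vector [velocity \<gamma> \<theta>, velocity \<gamma> \<theta>'] :: real^2^2) \<noteq> 0)"

text \<open>The labelling of the double points is given by the set \<open>Vflat\<close> of those labelled flat;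
  the remaining double points are the virtual ones.\<close>

definition flat_virtual_knot_diagram :: "(real \<Rightarrow> real^2) \<Rightarrow> (real^2) set \<Rightarrow> bool" where
  "flat_virtual_knot_diagram \<gamma> Vflat \<longleftrightarrow> generic_immersion \<gamma> \<and> Vflat \<subseteq> multiple_points \<gamma>"

definition fake_vertices :: "(real \<Rightarrow> real^2) \<Rightarrow> (real^2) set \<Rightarrow> bool" where
  "fake_vertices \<gamma> Vfake \<longleftrightarrow> finite Vfake \<and> Vfake \<subseteq> range \<gamma> - multiple_points \<gamma>"

text \<open>The components of the circle minus the preimage of \<open>V\<close> are represented by their lifts to \<open>\<real>\<close>,
  which are the components of \<open>{\<theta>. \<gamma> \<theta> \<notin> V}\<close>: open intervals \<open>C\<close> from the initial point \<open>Inf C\<close> to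
  the terminal point \<open>Sup C\<close> (the arc itself is \<open>\<gamma> ` C\<close>). A labelling of the arcs by \<open>1, \<dots>, k\<close> in
  order along the orientation lists consecutive lifts that go exactly once around the circle;
  the choice of \<open>a 1\<close> is the choice of the starting arc, and then \<open>k\<close> is necessarily the number of
  arcs.\<close>

definition arc_labelling ::
  "(real \<Rightarrow> real^2) \<Rightarrow> (real^2) set \<Rightarrow> nat \<Rightarrow> (nat \<Rightarrow> real set) \<Rightarrow> bool"
where
  "arc_labelling \<gamma> V k a \<longleftrightarrow>
    k \<ge> 1 \<and>
    (\<forall>i\<in>{1..k}. a i \<in> components {\<theta>. \<gamma> \<theta> \<notin> V}) \<and>
    (\<forall>i\<in>{1..<k}. Sup (a i) = Inf (a (i + 1))) \<and>
    Sup (a k) = Inf (a 1) + 1"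

definition prev_arc :: "nat \<Rightarrow> nat \<Rightarrow> nat" where
  "prev_arc k i = (if i = 1 then k else i - 1)"

text \<open>For arc \<open>i\<close> starting at a flat crossing: the label of the arc that enters this crossing along the
  other strand.\<close>

definition entering_arc :: "(real \<Rightarrow> real^2) \<Rightarrow> nat \<Rightarrow> (nat \<Rightarrow> real set) \<Rightarrow> nat \<Rightarrow> nat" where
  "entering_arc \<gamma> k a i =
    (THE j. j \<in> {1..k} \<and> \<gamma> (Sup (a j)) = \<gamma> (Inf (a i)) \<and> Sup (a j) - Inf (a i) \<notin> \<int>)"

text \<open>The entry \<open>x\<close> in position \<open>l\<close> of a multiple \<open>x e\<^sub>j\<close> of a standard row vector.\<close>

definition row_unit :: "('r, 'x) ring_scheme \<Rightarrow> 'r \<Rightarrow> nat \<Rightarrow> nat \<Rightarrow> 'r" where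
  "row_unit R x j l = (if l = j then x else \<zero>\<^bsub>R\<^esub>)"

text \<open>In the flat case, \<open>v\<close> is the velocity of the strand containing arcs \<open>i - 1\<close> and \<open>i\<close> at the
  crossing, and \<open>w\<close> that of the other strand; the former is strand 2 iff \<open>(w, v)\<close> is positively
  oriented, and strand 1 otherwise.\<close>

definition coloring_matrix ::
  "nat \<Rightarrow> (real \<Rightarrow> real^2) \<Rightarrow> (real^2) set \<Rightarrow> nat \<Rightarrow> (nat \<Rightarrow> real set) \<Rightarrow> nat \<Rightarrow> nat \<Rightarrow> free set"
where
  "coloring_matrix n \<gamma> Vflat k a i l =
    (let R = S_ring n; s = S_s n; s' = S_sinv n; t = S_t n;
         p = prev_arc k i; j = entering_arc \<gamma> k a i;
         v = velocity \<gamma> (Inf (a i)); w = velocity \<gamma> (Sup (a j))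
     in if \<gamma> (Inf (a i)) \<in> Vflat then
          if positively_oriented w v then
            row_unit R \<one>\<^bsub>R\<^esub> i l \<ominus>\<^bsub>R\<^esub> row_unit R s p l \<ominus>\<^bsub>R\<^esub> row_unit R t j l
          else
            row_unit R \<one>\<^bsub>R\<^esub> i l
              \<ominus>\<^bsub>R\<^esub> row_unit R (s' \<otimes>\<^bsub>R\<^esub> (\<one>\<^bsub>R\<^esub> \<ominus>\<^bsub>R\<^esub> t \<otimes>\<^bsub>R\<^esub> t)) p l
              \<oplus>\<^bsub>R\<^esub> row_unit R (s' \<otimes>\<^bsub>R\<^esub> t \<otimes>\<^bsub>R\<^esub> s) j l
        else row_unit R \<one>\<^bsub>R\<^esub> i l \<ominus>\<^bsub>R\<^esub> row_unit R \<one>\<^bsub>R\<^esub> p l)"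

end

theory Submission
  imports Defs
begin

text \<open>
  Changing the starting arc permutes the arcs cyclically, so the two coloring matrices are related by
  \<open>B i l = A (\<sigma> i) (\<sigma> l)\<close> for a bijection \<open>\<sigma>\<close> of the labels (lemma \<open>coloring_matrix_relabel\<close>).
  Comparing \<open>|A|\<close> and \<open>|B|\<close> at \<open>(k, k)\<close> is therefore comparing the quasideterminants of one matrix
  \<open>A\<close> at two diagonal positions \<open>k\<close> and \<open>m = \<sigma> k\<close>.

  The quasideterminant \<open>x = |A|\<close> at \<open>(k, k)\<close> is characterised by linear algebra: there is a column
  \<open>v\<close> with \<open>v k = 1\<close> and \<open>A v = x e\<^sub>k\<close>. Dually, for \<open>y = |A|\<close> at \<open>(m, m)\<close> there is a row \<open>z\<close> with
  \<open>z m = 1\<close> and \<open>z A = y e\<^sub>m\<close>. Evaluating \<open>z A v\<close> in two ways gives \<open>z k x = y v m\<close>, so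
  \<open>y = U x W\<close> with \<open>U = z k\<close> and \<open>W\<close> the inverse of \<open>v m\<close>, as soon as these two entries are units.

  This is decided modulo \<open>t\<close>. There, row \<open>i\<close> of \<open>A\<close> is \<open>e\<^sub>i - c\<^sub>i e\<^bsub>i-1\<^esub>\<close> with a unit \<open>c\<^sub>i\<close>, so that
  \<open>v i = c\<^sub>i v (i - 1)\<close> and \<open>z (i - 1) = z i c\<^sub>i\<close>. Hence \<open>v m\<close> is a product of units, and the
  product \<open>z i v i\<close> does not change as \<open>i\<close> runs from \<open>k\<close> (that is, \<open>0\<close>) to \<open>m\<close>, which gives
  \<open>z k = v m\<close> and \<open>\<pi> (U W) = 1\<close> (lemma \<open>quasidet_comparison\<close>). Units modulo \<open>t\<close> are units,
  since \<open>t\<close> generates a nilpotent ideal: it can be moved past \<open>s\<close> and its inverse, and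
  \<open>t ^ (n + 1) = 0\<close>. For the same reason the minors of the coloring matrices that define the
  quasideterminants are invertible, being unitriangular modulo \<open>t\<close> (lemma \<open>mat_inverse_mod\<close>).

  All ring computations are done with representatives in the free ring, filtered by the preimages of
  the powers of the ideal of \<open>t\<close>; equality in \<open>S\<^sub>n\<close> is congruence modulo the last of them.
\<close>

section \<open>Rings with a multiplicative filtration\<close>

text \<open>\<open>J e\<close> plays the role of the \<open>e\<close>-th power of a two-sided ideal, enlarged by an ideal that is to be
  divided out; that each \<open>J e\<close> is an ideal is the case \<open>J 0 = UNIV\<close> of multiplicativity.\<close>

locale ring_filtration =
  fixes J :: "nat \<Rightarrow> 'a::ring_1 set"
  assumes filt_0: "J 0 = UNIV"
    and filt_zero: "0 \<in> J e"
    and filt_add: "x \<in> J e \<Longrightarrow> y \<in> J e \<Longrightarrow> x + y \<in> J e"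
    and filt_mult: "x \<in> J d \<Longrightarrow> y \<in> J e \<Longrightarrow> x * y \<in> J (d + e)"
    and filt_Suc: "J (Suc e) \<subseteq> J e"
begin

lemma filt_left: "x \<in> J e \<Longrightarrow> y * x \<in> J e"
  using filt_mult[of y 0 x e] by (simp add: filt_0)

lemma filt_right: "x \<in> J e \<Longrightarrow> x * y \<in> J e"
  using filt_mult[of x e y 0] by (simp add: filt_0)

lemma filt_uminus: "x \<in> J e \<Longrightarrow> - x \<in> J e"
  using filt_left[of x e "- 1"] by simp

lemma filt_diff: "x \<in> J e \<Longrightarrow> y \<in> J e \<Longrightarrow> x - y \<in> J e"
  using filt_add[of x e "- y"] filt_uminus[of y e] by simp

lemma filt_sum: "(\<And>i. i \<in> X \<Longrightarrow> f i \<in> J e) \<Longrightarrow> (\<Sum>i\<in>X. f i) \<in> J e"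
  by (induction X rule: infinite_finite_induct) (auto intro: filt_zero filt_add)

lemma filt_antimono: "d \<le> e \<Longrightarrow> J e \<subseteq> J d"
  using filt_Suc by (rule lift_Suc_antimono_le)

lemma filt_trans: "x - y \<in> J e \<Longrightarrow> y - z \<in> J e \<Longrightarrow> x - z \<in> J e"
  using filt_add[of "x - y" e "y - z"] by simp

lemma filt_sym: "x - y \<in> J e \<Longrightarrow> y - x \<in> J e"
  using filt_uminus[of "x - y" e] by simp

lemma filt_power: "x \<in> J 1 \<Longrightarrow> x ^ e \<in> J e"
proof (induction e)
  case (Suc e)
  then show ?case using filt_mult[of x 1 "x ^ e" e] by simp
qed (simp add: filt_0)

definition unit_mod :: "nat \<Rightarrow> 'a \<Rightarrow> bool" where
  "unit_mod d x \<longleftrightarrow> (\<exists>y. x * y - 1 \<in> J d \<and> y * x - 1 \<in> J d)"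

lemma unit_mod_one: "unit_mod d 1"
  unfolding unit_mod_def by (rule exI[of _ 1]) (simp add: filt_zero)

lemma unit_mod_mult:
  assumes "unit_mod d x" "unit_mod d y"
  shows "unit_mod d (x * y)"
proof -
  obtain x' y' where x: "x * x' - 1 \<in> J d" "x' * x - 1 \<in> J d"
    and y: "y * y' - 1 \<in> J d" "y' * y - 1 \<in> J d"
    using assms by (auto simp: unit_mod_def)
  have "x * (y * y' - 1) * x' + (x * x' - 1) \<in> J d" "y' * (x' * x - 1) * y + (y' * y - 1) \<in> J d"
    using x y by (blast intro: filt_add filt_left filt_right)+
  then have "x * y * (y' * x') - 1 \<in> J d" "y' * x' * (x * y) - 1 \<in> J d"
    by (simp_all add: algebra_simps)
  then show ?thesis unfolding unit_mod_def by blast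
qed

lemma unit_mod_cong:
  assumes "unit_mod d x" "x - y \<in> J d"
  shows "unit_mod d y"
proof -
  obtain x' where x: "x * x' - 1 \<in> J d" "x' * x - 1 \<in> J d"
    using assms by (auto simp: unit_mod_def)
  have "(x * x' - 1) - (x - y) * x' \<in> J d" "(x' * x - 1) - x' * (x - y) \<in> J d"
    using x assms by (blast intro: filt_diff filt_left filt_right)+
  then have "y * x' - 1 \<in> J d" "x' * y - 1 \<in> J d"
    by (simp_all add: algebra_simps)
  then show ?thesis unfolding unit_mod_def by blast
qed

lemma geometric_sum:
  fixes w :: 'a
  shows "(1 - w) * (\<Sum>i<d. w ^ i) = 1 - w ^ d" "(\<Sum>i<d. w ^ i) * (1 - w) = 1 - w ^ d"
proof -
  have step: "(1 - w) * w ^ d = w ^ d - w ^ Suc d" "w ^ d * (1 - w) = w ^ d - w ^ Suc d" for d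
    by (simp_all add: algebra_simps power_commutes)
  show "(1 - w) * (\<Sum>i<d. w ^ i) = 1 - w ^ d"
    by (induction d) (simp_all add: distrib_left step del: power_Suc)
  show "(\<Sum>i<d. w ^ i) * (1 - w) = 1 - w ^ d"
    by (induction d) (simp_all add: distrib_right step del: power_Suc)
qed

text \<open>If \<open>y\<close> is an inverse modulo \<open>J 1\<close>, its errors \<open>1 - x y\<close> and \<open>1 - y x\<close> have \<open>d\<close>-th powers in
  \<open>J d\<close>; multiplying \<open>y\<close> by their geometric series yields a right and a left inverse modulo \<open>J d\<close>,
  which agree.\<close>

lemma unit_mod_lift:
  assumes "unit_mod 1 x"
  shows "unit_mod d x"
proof -
  obtain y where y: "x * y - 1 \<in> J 1" "y * x - 1 \<in> J 1"
    using assms by (auto simp: unit_mod_def)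
  define g where "g = (\<lambda>w::'a. \<Sum>i<d. w ^ i)"
  define r l where "r = y * g (1 - x * y)" and "l = g (1 - y * x) * y"
  have "x * r = 1 - (1 - x * y) ^ d"
    using geometric_sum(1)[of "1 - x * y" d] by (simp add: r_def g_def mult.assoc)
  then have r: "x * r - 1 \<in> J d"
    using filt_uminus[OF filt_power[OF filt_sym[OF y(1)]]] by simp
  have "l * x = 1 - (1 - y * x) ^ d"
    using geometric_sum(2)[of "1 - y * x" d] by (simp add: l_def g_def mult.assoc)
  then have l: "l * x - 1 \<in> J d"
    using filt_uminus[OF filt_power[OF filt_sym[OF y(2)]]] by simp
  \<comment> \<open>the usual argument that a left inverse agrees with a right inverse, written modulo \<open>J d\<close>\<close>
  have "l * (x * r - 1) * x - (l * x - 1) * r * x + (l * x - 1) \<in> J d"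
    using r l by (blast intro: filt_diff filt_add filt_left filt_right)
  then have "r * x - 1 \<in> J d"
    by (simp add: algebra_simps)
  with r show ?thesis unfolding unit_mod_def by blast
qed

end


section \<open>Inverting matrices that are unitriangular to first order\<close>

primrec mat_pow :: "nat set \<Rightarrow> (nat \<Rightarrow> nat \<Rightarrow> 'a::ring_1) \<Rightarrow> nat \<Rightarrow> nat \<Rightarrow> nat \<Rightarrow> 'a" where
  "mat_pow I N 0 = (\<lambda>i j. of_bool (i = j))"
| "mat_pow I N (Suc m) = (\<lambda>i j. \<Sum>l\<in>I. N i l * mat_pow I N m l j)"

lemma mat_pow_Suc_right:
  assumes "finite I" "i \<in> I" "j \<in> I"
  shows "mat_pow I N (Suc m) i j = (\<Sum>l\<in>I. mat_pow I N m i l * N l j)"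
  using assms(2)
proof (induction m arbitrary: i)
  case 0
  then show ?case using assms by (simp add: if_distrib if_distribR of_bool_def cong: if_cong)
next
  case (Suc m)
  have "mat_pow I N (Suc (Suc m)) i j = (\<Sum>h\<in>I. N i h * (\<Sum>l\<in>I. mat_pow I N m h l * N l j))"
    using Suc.IH by simp
  also have "\<dots> = (\<Sum>h\<in>I. \<Sum>l\<in>I. N i h * mat_pow I N m h l * N l j)"
    by (simp add: sum_distrib_left mult.assoc)
  also have "\<dots> = (\<Sum>l\<in>I. \<Sum>h\<in>I. N i h * mat_pow I N m h l * N l j)"
    by (rule sum.swap)
  finally show ?case by (simp add: sum_distrib_right)
qed

text \<open>Truncated after \<open>K\<close> terms, the Neumann series of \<open>N = 1 - M\<close> inverts \<open>M\<close> up to \<open>N ^ K\<close>.\<close>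

lemma mat_geometric_sum:
  fixes M :: "nat \<Rightarrow> nat \<Rightarrow> 'a::ring_1" and K :: nat
  assumes I: "finite I" "i \<in> I" "j \<in> I"
  defines "N \<equiv> \<lambda>i j. of_bool (i = j) - M i j"
  defines "C \<equiv> \<lambda>i j. \<Sum>m<K. mat_pow I N m i j"
  shows "(\<Sum>l\<in>I. M i l * C l j) = of_bool (i = j) - mat_pow I N K i j"
    and "(\<Sum>l\<in>I. C i l * M l j) = of_bool (i = j) - mat_pow I N K i j"
proof -
  have M: "M i j = of_bool (i = j) - N i j" for i j by (simp add: N_def)
  have delta: "(\<Sum>l\<in>I. of_bool (i = l) * f l) = f i" "(\<Sum>l\<in>I. f l * of_bool (l = j)) = f j" for f :: "nat \<Rightarrow> 'a"
    using I by (simp_all add: if_distrib if_distribR of_bool_def cong: if_cong)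
  have tele: "(\<Sum>m<K. mat_pow I N m i j - mat_pow I N (Suc m) i j) =
      of_bool (i = j) - mat_pow I N K i j"
    using sum_lessThan_telescope'[of "\<lambda>m. mat_pow I N m i j" K] by simp
  have "(\<Sum>l\<in>I. M i l * C l j) = C i j - (\<Sum>l\<in>I. N i l * C l j)"
    by (simp add: M left_diff_distrib sum_subtractf delta)
  also have "(\<Sum>l\<in>I. N i l * C l j) = (\<Sum>m<K. mat_pow I N (Suc m) i j)"
    unfolding C_def by (simp add: sum_distrib_left) (rule sum.swap)
  finally show "(\<Sum>l\<in>I. M i l * C l j) = of_bool (i = j) - mat_pow I N K i j"
    using tele by (simp only: C_def sum_subtractf)
  have "(\<Sum>l\<in>I. C i l * M l j) = C i j - (\<Sum>l\<in>I. C i l * N l j)"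
    by (simp add: M right_diff_distrib sum_subtractf delta)
  also have "(\<Sum>l\<in>I. C i l * N l j) = (\<Sum>m<K. \<Sum>l\<in>I. mat_pow I N m i l * N l j)"
    unfolding C_def by (simp add: sum_distrib_right) (rule sum.swap)
  also have "\<dots> = (\<Sum>m<K. mat_pow I N (Suc m) i j)"
    using mat_pow_Suc_right[OF I, of N] by simp
  finally show "(\<Sum>l\<in>I. C i l * M l j) = of_bool (i = j) - mat_pow I N K i j"
    using tele by (simp only: C_def sum_subtractf)
qed

context ring_filtration
begin

text \<open>Read an entry of the power as a sum over paths from \<open>i\<close> to \<open>j\<close>. A step either lowers the index
  by one, or it raises the filtration degree and then climbs by less than \<open>k\<close>; so \<open>m\<close> steps of which
  \<open>e\<close> raise the degree end at most at \<open>i - m + e k\<close>. An end point \<open>j\<close> beyond \<open>i - m + (e - 1) k\<close>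
  forces degree \<open>e\<close>.\<close>

lemma mat_pow_filt:
  assumes N: "\<And>i l. i \<in> I \<Longrightarrow> l \<in> I \<Longrightarrow> i \<noteq> Suc l \<Longrightarrow> N i l \<in> J 1"
    and I: "I \<subseteq> {1..k}" and "i \<in> I" "j \<in> I" "e * k + i < m + j + k"
  shows "mat_pow I N m i j \<in> J e"
  using assms(3-)
proof (induction m arbitrary: i e)
  case 0
  show ?case
  proof (cases e)
    case (Suc e')
    then have "i \<noteq> j" using 0 by auto
    then show ?thesis by (simp add: filt_zero)
  qed (simp add: filt_0)
next
  case (Suc m)
  have "N i l * mat_pow I N m l j \<in> J e" if l: "l \<in> I" for l
  proof (cases "i = Suc l")
    case True
    then show ?thesis using Suc.IH[OF l Suc.prems(2)] Suc.prems(3) by (auto intro: filt_left)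
  next
    case False
    show ?thesis
    proof (cases e)
      case (Suc e')
      have "l \<le> k" "1 \<le> i" using l I Suc.prems by auto
      then have "mat_pow I N m l j \<in> J e'"
        using Suc.IH[OF l Suc.prems(2), of e'] Suc.prems(3) Suc by simp
      then show ?thesis
        using filt_mult[OF N[OF Suc.prems(1) l False]] Suc by fastforce
    qed (simp add: filt_0)
  qed
  then show ?case by (auto intro: filt_sum)
qed

lemma mat_inverse_mod:
  fixes M :: "nat \<Rightarrow> nat \<Rightarrow> 'a"
  assumes M: "\<And>i l. i \<in> I \<Longrightarrow> l \<in> I \<Longrightarrow> i \<noteq> Suc l \<Longrightarrow> M i l - of_bool (i = l) \<in> J 1"
    and I: "I \<subseteq> {1..k}"
  shows "\<exists>C. \<forall>i\<in>I. \<forall>j\<in>I. (\<Sum>l\<in>I. M i l * C l j) - of_bool (i = j) \<in> J d \<and>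
                        (\<Sum>l\<in>I. C i l * M l j) - of_bool (i = j) \<in> J d"
proof -
  define N where "N = (\<lambda>i j. of_bool (i = j) - M i j)"
  define C where "C = (\<lambda>i j. \<Sum>m<d*k. mat_pow I N m i j)"
  have fin: "finite I" using I by (rule finite_subset) simp
  have "mat_pow I N (d*k) i j \<in> J d" if "i \<in> I" "j \<in> I" for i j
  proof (rule mat_pow_filt[OF _ I that])
    have "i \<le> k" "1 \<le> j" using that I by auto
    show "N i l \<in> J 1" if "i \<in> I" "l \<in> I" "i \<noteq> Suc l" for i l
      using filt_sym[OF M[OF that]] by (simp add: N_def)
    show "d * k + i < d * k + j + k" using \<open>i \<le> k\<close> \<open>1 \<le> j\<close> by simp
  qed
  then have "\<forall>i\<in>I. \<forall>j\<in>I. (\<Sum>l\<in>I. M i l * C l j) - of_bool (i = j) \<in> J d \<and>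
                        (\<Sum>l\<in>I. C i l * M l j) - of_bool (i = j) \<in> J d"
    using mat_geometric_sum[OF fin, of _ _ M "d*k"] unfolding N_def C_def
    by (simp add: filt_uminus)
  then show ?thesis by blast
qed

end

section \<open>Quasideterminants modulo the filtration\<close>

lemma atLeastAtMost_eq_insert_last: "k \<ge> 1 \<Longrightarrow> {1..k} = insert k {1..<k}" for k :: nat
  by auto

context ring_filtration
begin

text \<open>Here \<open>x\<close> is the quasideterminant at \<open>(k, k)\<close>. With \<open>C\<close> the inverse of the deleted matrix,
  \<open>v = (- C c, 1)\<close> solves the first \<open>k - 1\<close> rows of \<open>M v = 0\<close>, where \<open>c\<close> is the last column, and the
  last row then evaluates to \<open>x\<close>; \<open>z\<close> is the same construction for rows. The column uses that \<open>C\<close> is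
  a right inverse and the row that it is a left inverse.\<close>

lemma quasidet_vectors:
  fixes M C :: "nat \<Rightarrow> nat \<Rightarrow> 'a"
  assumes k: "k \<ge> 1"
    and right: "\<And>i j. i \<in> {1..<k} \<Longrightarrow> j \<in> {1..<k} \<Longrightarrow>
      (\<Sum>l\<in>{1..<k}. M i l * C l j) - of_bool (i = j) \<in> J d"
    and left: "\<And>i j. i \<in> {1..<k} \<Longrightarrow> j \<in> {1..<k} \<Longrightarrow>
      (\<Sum>l\<in>{1..<k}. C i l * M l j) - of_bool (i = j) \<in> J d"
  defines "x \<equiv> M k k - (\<Sum>q\<in>{1..<k}. \<Sum>p\<in>{1..<k}. M k q * C q p * M p k)"
  obtains v z where "v k = 1" "\<And>i. i \<in> {1..k} \<Longrightarrow> (\<Sum>l\<in>{1..k}. M i l * v l) - of_bool (i = k) * x \<in> J d"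
    and "z k = 1" "\<And>l. l \<in> {1..k} \<Longrightarrow> (\<Sum>i\<in>{1..k}. z i * M i l) - of_bool (l = k) * x \<in> J d"
proof -
  let ?I = "{1..<k}"
  define v where "v = (\<lambda>l. if l = k then 1 else - (\<Sum>p\<in>?I. C l p * M p k))"
  define z where "z = (\<lambda>l. if l = k then 1 else - (\<Sum>q\<in>?I. M k q * C q l))"
  have 1: "v k = 1" "z k = 1" by (simp_all add: v_def z_def)
  have delta: "(\<Sum>p\<in>?I. of_bool (i = p) * f p) = f i" "(\<Sum>p\<in>?I. f p * of_bool (p = i)) = f i"
    if "i \<in> ?I" for i and f :: "nat \<Rightarrow> 'a"
    using that by (simp_all add: if_distrib if_distribR of_bool_def cong: if_cong)
  have "(\<Sum>l\<in>?I. M i l * v l) = (\<Sum>l\<in>?I. - (\<Sum>p\<in>?I. M i l * C l p * M p k))" for i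
    by (rule sum.cong) (simp_all add: v_def sum_distrib_left mult.assoc)
  then have v: "(\<Sum>l\<in>{1..k}. M i l * v l) = M i k - (\<Sum>l\<in>?I. \<Sum>p\<in>?I. M i l * C l p * M p k)" for i
    unfolding atLeastAtMost_eq_insert_last[OF k] by (simp add: sum_negf) (simp add: v_def)
  have "(\<Sum>l\<in>?I. z l * M l i) = (\<Sum>l\<in>?I. - (\<Sum>q\<in>?I. M k q * C q l * M l i))" for i
    by (rule sum.cong) (simp_all add: z_def sum_distrib_right)
  then have z: "(\<Sum>l\<in>{1..k}. z l * M l i) = M k i - (\<Sum>l\<in>?I. \<Sum>q\<in>?I. M k q * C q l * M l i)" for i
    unfolding atLeastAtMost_eq_insert_last[OF k] by (simp add: sum_negf) (simp add: z_def)
  have 2: "(\<Sum>l\<in>{1..k}. M i l * v l) - of_bool (i = k) * x \<in> J d" if "i \<in> {1..k}" for i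
  proof (cases "i = k")
    case True
    then show ?thesis by (simp only: v) (simp add: x_def filt_zero)
  next
    case False
    with that have i: "i \<in> ?I" by auto
    have "(\<Sum>l\<in>{1..k}. M i l * v l) =
        - (\<Sum>p\<in>?I. ((\<Sum>l\<in>?I. M i l * C l p) - of_bool (i = p)) * M p k)"
      unfolding v left_diff_distrib sum_subtractf sum_distrib_right delta(1)[OF i]
      by simp (rule sum.swap)
    moreover have "- (\<Sum>p\<in>?I. ((\<Sum>l\<in>?I. M i l * C l p) - of_bool (i = p)) * M p k) \<in> J d"
      by (intro filt_uminus filt_sum filt_right right i)
    ultimately show ?thesis using False by simp
  qed
  have 3: "(\<Sum>l\<in>{1..k}. z l * M l i) - of_bool (i = k) * x \<in> J d" if "i \<in> {1..k}" for i
  proof (cases "i = k")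
    case True
    then show ?thesis by (simp only: z x_def) (subst sum.swap, simp add: filt_zero)
  next
    case False
    with that have i: "i \<in> ?I" by auto
    have "(\<Sum>l\<in>{1..k}. z l * M l i) =
        - (\<Sum>q\<in>?I. M k q * ((\<Sum>l\<in>?I. C q l * M l i) - of_bool (q = i)))"
      unfolding z right_diff_distrib sum_subtractf sum_distrib_left delta(2)[OF i]
      by (subst sum.swap) (simp add: mult.assoc)
    moreover have "- (\<Sum>q\<in>?I. M k q * ((\<Sum>l\<in>?I. C q l * M l i) - of_bool (q = i))) \<in> J d"
      by (intro filt_uminus filt_sum filt_left left i)
    ultimately show ?thesis using False by simp
  qed
  show thesis by (rule that[OF 1(1) 2 1(2) 3])
qed

text \<open>Computing \<open>z A v\<close> in both orders gives the first claim. For the other two, the equations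
  \<open>A v = x e\<^sub>k\<close> and \<open>z A = y e\<^sub>m\<close> become modulo \<open>J 1\<close> the recursions \<open>v i = c i * v (i - 1)\<close> for
  \<open>i \<noteq> k\<close> and \<open>z (i - 1) = z i * c i\<close> for \<open>i - 1 \<noteq> m\<close>, with indices read cyclically. On the way from
  \<open>k\<close> to \<open>m\<close> both are available, and they keep \<open>z i * v i\<close> constant.\<close>

lemma quasidet_comparison:
  fixes A :: "nat \<Rightarrow> nat \<Rightarrow> 'a"
  assumes "d \<ge> 1" and m: "m \<in> {1..k}"
    and A: "\<And>i l. i \<in> {1..k} \<Longrightarrow> l \<in> {1..k} \<Longrightarrow>
      A i l - (of_bool (l = i) - of_bool (l = prev_arc k i) * c i) \<in> J 1"
    and c: "\<And>i. i \<in> {1..k} \<Longrightarrow> unit_mod 1 (c i)"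
    and v: "v k = 1" "\<And>i. i \<in> {1..k} \<Longrightarrow> (\<Sum>l\<in>{1..k}. A i l * v l) - of_bool (i = k) * x \<in> J d"
    and z: "z m = 1" "\<And>l. l \<in> {1..k} \<Longrightarrow> (\<Sum>i\<in>{1..k}. z i * A i l) - of_bool (l = m) * y \<in> J d"
  shows "z k * x - y * v m \<in> J d" "z k - v m \<in> J 1" "unit_mod 1 (v m)"
proof -
  let ?I = "{1..k}"
  have k: "k \<in> ?I" using m by auto
  have d: "J d \<subseteq> J 1" using filt_antimono assms(1) by blast
  have delta: "(\<Sum>p\<in>?I. of_bool (p = i) * f p) = f i" "(\<Sum>p\<in>?I. f p * of_bool (p = i)) = f i"
    if "i \<in> ?I" for i and f :: "nat \<Rightarrow> 'a"
    using that by (simp_all add: if_distrib if_distribR of_bool_def cong: if_cong)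
  have delta': "(\<Sum>p\<in>?I. f p * (of_bool (p = i) * g)) = f i * g" if "i \<in> ?I" for i f and g :: 'a
    using delta(1)[OF that, of "\<lambda>p. f p * g"] by (simp add: of_bool_def if_distrib if_distribR cong: if_cong)
  have prev: "prev_arc k i \<in> ?I" if "i \<in> ?I" for i
    using that by (auto simp: prev_arc_def)
  have prev_inj: "i = j" if "prev_arc k i = prev_arc k j" "i \<in> ?I" "j \<in> ?I" for i j
    using that by (auto simp: prev_arc_def split: if_splits)

  let ?S = "\<Sum>i\<in>?I. \<Sum>l\<in>?I. z i * A i l * v l"
  have "(\<Sum>i\<in>?I. z i * ((\<Sum>l\<in>?I. A i l * v l) - of_bool (i = k) * x)) \<in> J d"
    by (intro filt_sum filt_left v)
  then have 1: "?S - z k * x \<in> J d"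
    by (simp only: right_diff_distrib sum_subtractf sum_distrib_left mult.assoc delta'[OF k])
  have "(\<Sum>l\<in>?I. ((\<Sum>i\<in>?I. z i * A i l) - of_bool (l = m) * y) * v l) \<in> J d"
    by (intro filt_sum filt_right z)
  then have "(\<Sum>l\<in>?I. \<Sum>i\<in>?I. z i * A i l * v l) - y * v m \<in> J d"
    by (simp only: left_diff_distrib sum_subtractf sum_distrib_right mult.assoc delta(1)[OF m])
  then have 2: "?S - y * v m \<in> J d"
    by (simp only: sum.swap[of "\<lambda>l i. z i * A i l * v l"])
  from 1 2 show "z k * x - y * v m \<in> J d"
    by (rule filt_trans[OF filt_sym])

  have row: "v i - c i * v (prev_arc k i) \<in> J 1" if i: "i \<in> ?I" "i \<noteq> k" for i
  proof -
    have "(\<Sum>l\<in>?I. A i l * v l) \<in> J 1" using v(2)[OF i(1)] i(2) d by auto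
    moreover have "(\<Sum>l\<in>?I. (A i l - (of_bool (l = i) - of_bool (l = prev_arc k i) * c i)) * v l) \<in> J 1"
      by (intro filt_sum filt_right A i)
    then have "(\<Sum>l\<in>?I. A i l * v l) - (v i - c i * v (prev_arc k i)) \<in> J 1"
      by (simp only: left_diff_distrib sum_subtractf mult.assoc delta(1)[OF i(1)] delta(1)[OF prev[OF i(1)]])
    ultimately have "(\<Sum>l\<in>?I. A i l * v l) - ((\<Sum>l\<in>?I. A i l * v l) - (v i - c i * v (prev_arc k i))) \<in> J 1"
      by (rule filt_diff)
    then show ?thesis by simp
  qed
  have col: "z (prev_arc k i) - z i * c i \<in> J 1" if i: "i \<in> ?I" "prev_arc k i \<noteq> m" for i
  proof -
    let ?p = "prev_arc k i"
    have eq: "(\<Sum>h\<in>?I. z h * (A h ?p - (of_bool (?p = h) - of_bool (?p = prev_arc k h) * c h))) =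
        (\<Sum>h\<in>?I. z h * A h ?p - (z h * of_bool (h = ?p) - z h * c h * of_bool (h = i)))"
    proof (rule sum.cong)
      fix h assume "h \<in> ?I"
      then have "?p = prev_arc k h \<longleftrightarrow> h = i" using prev_inj[OF _ i(1)] by auto
      then show "z h * (A h ?p - (of_bool (?p = h) - of_bool (?p = prev_arc k h) * c h)) =
          z h * A h ?p - (z h * of_bool (h = ?p) - z h * c h * of_bool (h = i))"
        by (auto simp: algebra_simps)
    qed simp
    have "(\<Sum>h\<in>?I. z h * A h ?p) \<in> J 1" using z(2)[OF prev[OF i(1)]] i(2) d by auto
    moreover have "(\<Sum>h\<in>?I. z h * (A h ?p - (of_bool (?p = h) - of_bool (?p = prev_arc k h) * c h))) \<in> J 1"
      by (intro filt_sum filt_left A prev i)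
    then have "(\<Sum>h\<in>?I. z h * A h ?p) - (z ?p - z i * c i) \<in> J 1"
      by (simp only: eq sum_subtractf delta(2)[OF i(1)] delta(2)[OF prev[OF i(1)]])
    ultimately have "(\<Sum>h\<in>?I. z h * A h ?p) - ((\<Sum>h\<in>?I. z h * A h ?p) - (z ?p - z i * c i)) \<in> J 1"
      by (rule filt_diff)
    then show ?thesis by simp
  qed
  have main: "z k - z i * v i \<in> J 1 \<and> unit_mod 1 (v i)" if "m < k" "1 \<le> i" "i \<le> m" for i
    using that(2,3)
  proof (induction i rule: nat_induct_at_least)
    case base
    then have 1: "1 \<in> ?I" "1 \<noteq> k" "prev_arc k 1 = k" using that by (auto simp: prev_arc_def)
    have r: "v 1 - c 1 \<in> J 1" using row[OF 1(1,2)] 1(3) v(1) by simp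
    have "z k - z 1 * c 1 \<in> J 1" using col[OF 1(1)] 1(3) that by simp
    then have "z k - z 1 * c 1 - z 1 * (v 1 - c 1) \<in> J 1"
      using r by (blast intro: filt_diff filt_left)
    then have "z k - z 1 * v 1 \<in> J 1" by (simp add: algebra_simps)
    then show ?case using unit_mod_cong[OF c[OF 1(1)] filt_sym[OF r]] by simp
  next
    case (Suc i)
    then have i: "Suc i \<in> ?I" "Suc i \<noteq> k" "prev_arc k (Suc i) = i" "i \<noteq> m"
      using that by (auto simp: prev_arc_def)
    have r: "v (Suc i) - c (Suc i) * v i \<in> J 1" using row[OF i(1,2)] i(3) by simp
    have "z i - z (Suc i) * c (Suc i) \<in> J 1" using col[OF i(1)] i(3,4) by simp
    then have "(z k - z i * v i) + (z i - z (Suc i) * c (Suc i)) * v i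
        - z (Suc i) * (v (Suc i) - c (Suc i) * v i) \<in> J 1"
      using r Suc by (auto intro!: filt_diff filt_add intro: filt_left filt_right)
    then have "z k - z (Suc i) * v (Suc i) \<in> J 1" by (simp add: algebra_simps)
    moreover have "unit_mod 1 (c (Suc i) * v i)"
      using Suc c[OF i(1)] by (auto intro: unit_mod_mult)
    ultimately show ?case using unit_mod_cong[OF _ filt_sym[OF r]] by blast
  qed
  have "z k - v m \<in> J 1 \<and> unit_mod 1 (v m)"
  proof (cases "m = k")
    case True
    then show ?thesis using v(1) z(1) by (simp add: filt_zero unit_mod_one)
  next
    case False
    then show ?thesis using main[of m] m z(1) by simp
  qed
  then show "z k - v m \<in> J 1" "unit_mod 1 (v m)" by simp_all
qed

end

section \<open>The filtration of \<open>S\<^sub>n\<close> by powers of \<open>t\<close>\<close>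

text \<open>The preimage in the free ring of the \<open>e\<close>-th power of the ideal of \<open>S\<^sub>n\<close> generated by \<open>t\<close>. Left
  multiples of \<open>t ^ e\<close> are the whole power because \<open>t\<close> can be moved to the right past every element.\<close>

definition S_filt :: "nat \<Rightarrow> nat \<Rightarrow> free set" where
  "S_filt n e = {x. \<exists>y. x - y * gen Gt ^ e \<in> S_ideal n}"

lemma free_induct [case_names one gen mult uminus add]:
  assumes one: "P 1" and gen: "\<And>g. P (gen g)"
    and mult: "\<And>x y. P x \<Longrightarrow> P y \<Longrightarrow> P (x * y)"
    and uminus: "\<And>x. P x \<Longrightarrow> P (- x)"
    and add: "\<And>x y. P x \<Longrightarrow> P y \<Longrightarrow> P (x + y)"
  shows "P (x :: free)"
proof -
  have zero: "P 0" using add[OF one uminus[OF one]] by simp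
  have word: "P (Poly_Mapping.single (Word us) 1)" for us
  proof (induction us)
    case Nil
    then show ?case using one by (simp flip: zero_word_def)
  next
    case (Cons u us)
    have "(Poly_Mapping.single (Word (u # us)) 1 :: free) = gen u * Poly_Mapping.single (Word us) 1"
      by (simp add: gen_def mult_single)
    then show ?case using mult[OF gen Cons] by simp
  qed
  have nat: "P (Poly_Mapping.single (Word us) (int c))" for us c
    by (induction c) (auto simp: zero single_add intro: add word)
  have single: "P (Poly_Mapping.single w c)" for w c
    using nat[of _ "nat \<bar>c\<bar>"] uminus[OF nat[of _ "nat \<bar>c\<bar>"]]
    by (cases w; cases "c \<ge> 0") (simp_all add: single_uminus)
  show "P x"
  proof (induction x rule: update_induct)
    case const
    then show ?case by (rule zero)
  next
    case (update f a b)
    have "Poly_Mapping.update a b f = f + Poly_Mapping.single a b"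
      using update by (intro poly_mapping_eqI) (auto simp: lookup_update lookup_add lookup_single in_keys_iff when_def)
    then show ?case using add[OF update.IH single] by simp
  qed
qed

text \<open>The relators say \<open>t s = s f(t)\<close> and \<open>t s' = s' g(t)\<close> with polynomials \<open>f\<close> and \<open>g\<close> without constant
  term, so a factor \<open>t\<close> can be split off on the right; the property passes to sums and products.\<close>

lemma S_t_commute: "\<exists>y. gen Gt * x - y * gen Gt \<in> S_ideal n"
proof (induction x rule: free_induct)
  case one
  show ?case by (rule exI[of _ 1]) (simp add: S_ideal_closed)
next
  case (gen g)
  have rel: "gen Gt * gen Gs - gen Gs * (\<Sum>i=1..n. gen Gt ^ i) \<in> S_ideal n"
    "gen Gt * gen Gsbar - gen Gsbar * (\<Sum>i=1..n. (- 1) ^ (i - 1) * gen Gt ^ i) \<in> S_ideal n"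
    using S_relators_subset[of n] by (auto simp: S_relators_def Let_def)
  have pow: "gen Gt ^ i = gen Gt ^ (i - 1) * gen Gt" if "i \<in> {1..n}" for i
    using that by (cases i) (auto simp: power_commutes)
  have "(\<Sum>i=1..n. gen Gt ^ i) = (\<Sum>i=1..n. gen Gt ^ (i - 1)) * gen Gt"
    "(\<Sum>i=1..n. (- 1) ^ (i - 1) * gen Gt ^ i) = (\<Sum>i=1..n. (- 1) ^ (i - 1) * gen Gt ^ (i - 1)) * gen Gt"
    unfolding sum_distrib_right by (rule sum.cong; use pow in \<open>simp add: mult.assoc\<close>)+
  note rel = rel[unfolded this, folded mult.assoc]
  show ?case
  proof (cases g)
    case Gt
    show ?thesis by (rule exI[of _ "gen Gt"]) (simp add: Gt S_ideal_closed)
  qed (use rel in blast)+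
next
  case (mult x y)
  then obtain x' y' where "gen Gt * x - x' * gen Gt \<in> S_ideal n" "gen Gt * y - y' * gen Gt \<in> S_ideal n"
    by blast
  then have "(gen Gt * x - x' * gen Gt) * y + x' * (gen Gt * y - y' * gen Gt) \<in> S_ideal n"
    by (blast intro: S_ideal_closed)
  then show ?case by (intro exI[of _ "x' * y'"]) (simp add: algebra_simps)
next
  case (uminus x)
  then obtain x' where "gen Gt * x - x' * gen Gt \<in> S_ideal n" by blast
  from S_ideal_closed(3)[OF this, of "- 1"] show ?case
    by (intro exI[of _ "- x'"]) (simp add: algebra_simps)
next
  case (add x y)
  then obtain x' y' where "gen Gt * x - x' * gen Gt \<in> S_ideal n" "gen Gt * y - y' * gen Gt \<in> S_ideal n"
    by blast
  from S_ideal_closed(2)[OF this] show ?case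
    by (intro exI[of _ "x' + y'"]) (simp add: algebra_simps)
qed

lemma S_t_power_commute: "\<exists>y. gen Gt ^ e * x - y * gen Gt ^ e \<in> S_ideal n"
proof (induction e arbitrary: x)
  case 0
  show ?case by (rule exI[of _ x]) (simp add: S_ideal_closed)
next
  case (Suc e)
  obtain x' where x': "gen Gt * x - x' * gen Gt \<in> S_ideal n" using S_t_commute by blast
  obtain y where "gen Gt ^ e * x' - y * gen Gt ^ e \<in> S_ideal n" using Suc by blast
  with x' have "gen Gt ^ e * (gen Gt * x - x' * gen Gt) + (gen Gt ^ e * x' - y * gen Gt ^ e) * gen Gt \<in> S_ideal n"
    by (blast intro: S_ideal_closed)
  then show ?case by (intro exI[of _ y]) (simp add: algebra_simps power_Suc2 del: power_Suc)
qed

interpretation S: ring_filtration "S_filt n" for n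
proof
  show "S_filt n 0 = UNIV"
    by (auto simp: S_filt_def) (metis S_ideal_closed(1) diff_self)
  show "0 \<in> S_filt n e" for e
    unfolding S_filt_def using S_ideal_closed(1)[of n] by (auto intro!: exI[of _ 0])
  show "x + y \<in> S_filt n e" if xy: "x \<in> S_filt n e" "y \<in> S_filt n e" for x y e
  proof -
    obtain x' y' where "x - x' * gen Gt ^ e \<in> S_ideal n" "y - y' * gen Gt ^ e \<in> S_ideal n"
      using xy by (auto simp: S_filt_def)
    from S_ideal_closed(2)[OF this] show ?thesis
      unfolding S_filt_def by (auto intro!: exI[of _ "x' + y'"] simp: algebra_simps)
  qed
  show "x * y \<in> S_filt n (d + e)" if xy: "x \<in> S_filt n d" "y \<in> S_filt n e" for x y d e
  proof -
    let ?t = "gen Gt"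
    obtain x' y' where x': "x - x' * ?t ^ d \<in> S_ideal n" and y': "y - y' * ?t ^ e \<in> S_ideal n"
      using xy by (auto simp: S_filt_def)
    obtain z where z: "?t ^ d * y' - z * ?t ^ d \<in> S_ideal n" using S_t_power_commute by blast
    have "(x - x' * ?t ^ d) * y + x' * ?t ^ d * (y - y' * ?t ^ e) + x' * (?t ^ d * y' - z * ?t ^ d) * ?t ^ e \<in> S_ideal n"
      using x' y' z by (blast intro: S_ideal_closed)
    then have "x * y - x' * z * ?t ^ (d + e) \<in> S_ideal n"
      by (simp add: algebra_simps power_add)
    then show ?thesis unfolding S_filt_def by blast
  qed
  show "S_filt n (Suc e) \<subseteq> S_filt n e" for e
  proof
    fix x assume "x \<in> S_filt n (Suc e)"
    then obtain y where "x - y * gen Gt * gen Gt ^ e \<in> S_ideal n"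
      by (auto simp: S_filt_def mult.assoc)
    then show "x \<in> S_filt n e" unfolding S_filt_def by blast
  qed
qed

lemma S_filt_top: "S_filt n (Suc n) = S_ideal n"
proof (intro equalityI subsetI)
  have t: "gen Gt ^ Suc n \<in> S_ideal n"
    using S_relators_subset[of n] by (auto simp: S_relators_def Let_def)
  fix x
  {
    assume "x \<in> S_filt n (Suc n)"
    then obtain y where y: "x - y * gen Gt ^ Suc n \<in> S_ideal n" by (auto simp: S_filt_def)
    from S_ideal_closed(2)[OF y S_ideal_closed(3)[OF t, of y]]
    show "x \<in> S_ideal n" by simp
  next
    assume "x \<in> S_ideal n"
    then show "x \<in> S_filt n (Suc n)" by (auto simp: S_filt_def intro!: exI[of _ 0])
  }
qed

lemma S_filt_1_subset: "S_filt n 1 \<subseteq> S_ideal 0"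
proof
  fix x assume "x \<in> S_filt n 1"
  then obtain y where y: "x - y * gen Gt \<in> S_ideal 0"
    using S_ideal_subset[of n] by (auto simp: S_filt_def)
  from S_ideal_closed(2)[OF y S_ideal_closed(3)[OF gen_Gt_S_ideal0, of y]]
  show "x \<in> S_ideal 0" by simp
qed

lemma gen_Gt_S_filt: "gen Gt \<in> S_filt n 1"
  unfolding S_filt_def using S_ideal_closed(1)[of n] by (auto intro!: exI[of _ 1])

section \<open>Quasideterminants over \<open>S\<^sub>n\<close>\<close>

lemma S_class_ops:
  "\<one>\<^bsub>S_ring n\<^esub> = S_class n 1" "\<zero>\<^bsub>S_ring n\<^esub> = S_class n 0"
  "S_class n x \<oplus>\<^bsub>S_ring n\<^esub> S_class n y = S_class n (x + y)"
  "S_class n x \<otimes>\<^bsub>S_ring n\<^esub> S_class n y = S_class n (x * y)"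
  "S_class n x \<ominus>\<^bsub>S_ring n\<^esub> S_class n y = S_class n (x - y)"
proof -
  interpret R: ring "S_ring n" by (rule ring_S_ring)
  show one: "\<one>\<^bsub>S_ring n\<^esub> = S_class n 1"
    using ring_hom_one[OF S_class_hom] by simp
  show zero: "\<zero>\<^bsub>S_ring n\<^esub> = S_class n 0"
    using ring_hom_zero[OF S_class_hom ring_free_ring ring_S_ring] by simp
  show add: "S_class n x \<oplus>\<^bsub>S_ring n\<^esub> S_class n y = S_class n (x + y)" for x y
    using ring_hom_add[OF S_class_hom] by simp
  show "S_class n x \<otimes>\<^bsub>S_ring n\<^esub> S_class n y = S_class n (x * y)"
    using ring_hom_mult[OF S_class_hom] by simp
  have "\<ominus>\<^bsub>S_ring n\<^esub> S_class n y = S_class n (- y)"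
    by (rule R.minus_equality) (simp_all add: add zero carrier_S_ring)
  then show "S_class n x \<ominus>\<^bsub>S_ring n\<^esub> S_class n y = S_class n (x - y)"
    by (simp add: a_minus_def add)
qed

lemma S_class_sum: "(\<Oplus>\<^bsub>S_ring n\<^esub>i\<in>X. S_class n (f i)) = S_class n (\<Sum>i\<in>X. f i)"
proof -
  interpret R: ring "S_ring n" by (rule ring_S_ring)
  show ?thesis
    by (induction X rule: infinite_finite_induct)
      (simp_all add: R.finsum_infinite S_class_ops carrier_S_ring)
qed

lemma S_class_eq_iff: "S_class n x = S_class n y \<longleftrightarrow> x - y \<in> S_filt n (Suc n)"
proof
  assume "S_class n x = S_class n y"
  then have "x \<in> S_class n y" using S_ideal_closed(1)[of n] by (force simp: S_class_eq)
  then show "x - y \<in> S_filt n (Suc n)" by (auto simp: S_class_eq S_filt_top)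
next
  assume "x - y \<in> S_filt n (Suc n)"
  then have xy: "x - y \<in> S_ideal n" "y - x \<in> S_ideal n"
    using S.filt_sym[of x y n "Suc n"] by (simp_all add: S_filt_top)
  have "i + x \<in> S_class n y" if "i \<in> S_ideal n" "x - y \<in> S_ideal n" for i x y
    using S_ideal_closed(2)[OF that] by (auto simp: S_class_eq intro!: exI[of _ "i + (x - y)"])
  with xy show "S_class n x = S_class n y"
    unfolding S_class_eq by (auto simp: S_class_eq)
qed

lemma S_class_of_bool:
  "(if P then \<one>\<^bsub>S_ring n\<^esub> else \<zero>\<^bsub>S_ring n\<^esub>) = S_class n (of_bool P)"
  by (cases P) (simp_all only: S_class_ops if_True if_False of_bool_eq)

lemma S_class_Units:
  assumes "x * y - 1 \<in> S_filt n (Suc n)" "y * x - 1 \<in> S_filt n (Suc n)"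
  shows "S_class n x \<in> Units (S_ring n)"
proof -
  have "S_class n x \<otimes>\<^bsub>S_ring n\<^esub> S_class n y = \<one>\<^bsub>S_ring n\<^esub>"
    "S_class n y \<otimes>\<^bsub>S_ring n\<^esub> S_class n x = \<one>\<^bsub>S_ring n\<^esub>"
    by (simp_all only: S_class_ops S_class_eq_iff assms)
  moreover have "S_class n x \<in> carrier (S_ring n)" "S_class n y \<in> carrier (S_ring n)"
    by (simp_all add: carrier_S_ring)
  ultimately show ?thesis unfolding Units_def by blast
qed

lemma is_mat_inverse_S_class:
  assumes "\<And>i j. i \<in> I \<Longrightarrow> j \<in> I \<Longrightarrow> M i j = S_class n (M' i j)"
    and "\<And>i j. i \<in> I \<Longrightarrow> j \<in> I \<Longrightarrow> C i j = S_class n (C' i j)"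
  shows "is_mat_inverse (S_ring n) I I M C \<longleftrightarrow>
    (\<forall>i\<in>I. \<forall>j\<in>I. (\<Sum>l\<in>I. M' i l * C' l j) - of_bool (i = j) \<in> S_filt n (Suc n) \<and>
                  (\<Sum>l\<in>I. C' i l * M' l j) - of_bool (i = j) \<in> S_filt n (Suc n))"
proof -
  interpret R: ring "S_ring n" by (rule ring_S_ring)
  have "(\<Oplus>\<^bsub>S_ring n\<^esub>l\<in>I. M i l \<otimes>\<^bsub>S_ring n\<^esub> C l j) = S_class n (\<Sum>l\<in>I. M' i l * C' l j)"
    "(\<Oplus>\<^bsub>S_ring n\<^esub>l\<in>I. C i l \<otimes>\<^bsub>S_ring n\<^esub> M l j) = S_class n (\<Sum>l\<in>I. C' i l * M' l j)"
    if "i \<in> I" "j \<in> I" for i j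
    unfolding S_class_sum[symmetric]
    using that by (intro R.finsum_cong'; simp add: assms S_class_ops carrier_S_ring)+
  then show ?thesis
    unfolding is_mat_inverse_def S_class_of_bool
    by (auto simp: assms S_class_eq_iff carrier_S_ring)
qed

lemma quasidet_defined_S_class:
  assumes M: "\<And>i j. i \<in> {1..k} \<Longrightarrow> j \<in> {1..k} \<Longrightarrow> M i j = S_class n (M' i j)"
    and shape: "\<And>i l. i \<in> {1..<k} \<Longrightarrow> l \<in> {1..<k} \<Longrightarrow> i \<noteq> Suc l \<Longrightarrow>
      M' i l - of_bool (i = l) \<in> S_filt n 1"
  shows "quasidet_defined (S_ring n) k M k k"
proof -
  have I: "{1..k} - {k} = {1..<k}" by auto
  obtain C where "\<forall>i\<in>{1..<k}. \<forall>j\<in>{1..<k}.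
      (\<Sum>l\<in>{1..<k}. M' i l * C l j) - of_bool (i = j) \<in> S_filt n (Suc n) \<and>
      (\<Sum>l\<in>{1..<k}. C i l * M' l j) - of_bool (i = j) \<in> S_filt n (Suc n)"
    using S.mat_inverse_mod[of "{1..<k}" M' n k "Suc n"] shape by fastforce
  then have "is_mat_inverse (S_ring n) {1..<k} {1..<k} M (\<lambda>i j. S_class n (C i j))"
    by (subst is_mat_inverse_S_class[where M' = M' and C' = C]) (use M in auto)
  then show ?thesis unfolding quasidet_defined_def I by blast
qed

text \<open>Lifting the chosen inverse of the deleted matrix to the free ring moves the computation there,
  whichever inverse the choice operator returns.\<close>

lemma quasidet_S_class_vectors:
  assumes k: "k \<ge> 1" and defd: "quasidet_defined (S_ring n) k M k k"
    and M: "\<And>i j. i \<in> {1..k} \<Longrightarrow> j \<in> {1..k} \<Longrightarrow> M i j = S_class n (M' i j)"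
  obtains x v z where "quasidet (S_ring n) k M k k = S_class n x"
    and "v k = 1" "\<And>i. i \<in> {1..k} \<Longrightarrow> (\<Sum>l\<in>{1..k}. M' i l * v l) - of_bool (i = k) * x \<in> S_filt n (Suc n)"
    and "z k = 1" "\<And>l. l \<in> {1..k} \<Longrightarrow> (\<Sum>i\<in>{1..k}. z i * M' i l) - of_bool (l = k) * x \<in> S_filt n (Suc n)"
proof -
  interpret R: ring "S_ring n" by (rule ring_S_ring)
  let ?I = "{1..<k}"
  have I: "{1..k} - {k} = ?I" by auto
  define C where "C = (SOME C. is_mat_inverse (S_ring n) ?I ?I M C)"
  define C' where "C' = (\<lambda>i j. SOME x. C i j = S_class n x)"
  define x where "x = M' k k - (\<Sum>q\<in>?I. \<Sum>p\<in>?I. M' k q * C' q p * M' p k)"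
  \<comment> \<open>for \<open>k = 1\<close> the deleted matrix is empty, and any function is its inverse\<close>
  have "\<exists>C. is_mat_inverse (S_ring n) ?I ?I M C"
  proof (cases "k = 1")
    case True
    then show ?thesis by (simp add: is_mat_inverse_def)
  next
    case False
    then show ?thesis using defd unfolding quasidet_defined_def I by blast
  qed
  then have inv: "is_mat_inverse (S_ring n) ?I ?I M C"
    unfolding C_def by (rule someI_ex)
  have C: "C i j = S_class n (C' i j)" if "i \<in> ?I" "j \<in> ?I" for i j
  proof -
    have "\<exists>x. C i j = S_class n x"
      using inv that unfolding is_mat_inverse_def carrier_S_ring by blast
    then show ?thesis unfolding C'_def by (rule someI_ex)
  qed
  have M_I: "M i j = S_class n (M' i j)" if "i \<in> ?I" "j \<in> ?I" for i j
    using M that by simp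
  have "(\<Sum>l\<in>?I. M' i l * C' l j) - of_bool (i = j) \<in> S_filt n (Suc n)"
    "(\<Sum>l\<in>?I. C' i l * M' l j) - of_bool (i = j) \<in> S_filt n (Suc n)" if "i \<in> ?I" "j \<in> ?I" for i j
    using iffD1[OF is_mat_inverse_S_class[OF M_I C] inv] that by blast+
  note vec = S.quasidet_vectors[OF k this, folded x_def]
  have qd: "quasidet (S_ring n) k M k k = S_class n x"
  proof (cases "k = 1")
    case True
    then show ?thesis using M[of 1 1] by (simp add: quasidet_def x_def)
  next
    case False
    have inner: "(\<Oplus>\<^bsub>S_ring n\<^esub>p\<in>?I. M k q \<otimes>\<^bsub>S_ring n\<^esub> C q p \<otimes>\<^bsub>S_ring n\<^esub> M p k) =
        S_class n (\<Sum>p\<in>?I. M' k q * C' q p * M' p k)" if "q \<in> ?I" for q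
      unfolding S_class_sum[symmetric] using k that
      by (intro R.finsum_cong'; simp add: M C S_class_ops carrier_S_ring)
    have "(\<Oplus>\<^bsub>S_ring n\<^esub>q\<in>?I. \<Oplus>\<^bsub>S_ring n\<^esub>p\<in>?I. M k q \<otimes>\<^bsub>S_ring n\<^esub> C q p \<otimes>\<^bsub>S_ring n\<^esub> M p k) =
        S_class n (\<Sum>q\<in>?I. \<Sum>p\<in>?I. M' k q * C' q p * M' p k)"
      by (subst S_class_sum[symmetric], intro R.finsum_cong') (use inner in \<open>simp_all add: carrier_S_ring\<close>)
    then show ?thesis
      using False k M[of k k] unfolding quasidet_def I Let_def C_def[symmetric]
      by (simp add: S_class_sum S_class_ops x_def)
  qed
  show thesis by (rule vec) (assumption | rule that[OF qd])+
qed


section \<open>Change of the starting arc\<close>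

lemma s_unit_mod: "S.unit_mod n 1 (gen Gs)" "S.unit_mod n 1 (gen Gsbar)"
proof -
  have "gen Gs * gen Gsbar - 1 \<in> S_filt n 1" "gen Gsbar * gen Gs - 1 \<in> S_filt n 1"
    using S_relators_subset[of n] S.filt_antimono[of 1 "Suc n" n]
    by (auto simp: S_relators_def Let_def S_filt_top)
  then show "S.unit_mod n 1 (gen Gs)" "S.unit_mod n 1 (gen Gsbar)"
    unfolding S.unit_mod_def by blast+
qed

text \<open>Modulo \<open>t\<close> the other strand at a flat crossing disappears from the row, wherever its entering
  arc stands, and \<open>c i\<close> is \<open>s\<close>, the inverse of \<open>s\<close>, or \<open>1\<close> according to the three kinds of rows.\<close>

lemma coloring_matrix_first_order:
  obtains A c where "\<And>i l. coloring_matrix n \<gamma> Vflat k a i l = S_class n (A i l)"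
    and "\<And>i l. A i l - (of_bool (l = i) - of_bool (l = prev_arc k i) * c i) \<in> S_filt n 1"
    and "\<And>i. S.unit_mod n 1 (c i)"
proof -
  define c where "c = (\<lambda>i. if \<gamma> (Inf (a i)) \<notin> Vflat then 1
    else if positively_oriented (velocity \<gamma> (Sup (a (entering_arc \<gamma> k a i)))) (velocity \<gamma> (Inf (a i)))
    then gen Gs else gen Gsbar)"
  have unit: "row_unit (S_ring n) (S_class n x) j l = S_class n (of_bool (l = j) * x)" for x j l
    by (simp add: row_unit_def S_class_ops)
  have "\<exists>x. coloring_matrix n \<gamma> Vflat k a i l = S_class n x \<and>
      x - (of_bool (l = i) - of_bool (l = prev_arc k i) * c i) \<in> S_filt n 1" for i l
  proof -
    let ?p = "prev_arc k i" and ?j = "entering_arc \<gamma> k a i"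
    let ?t = "gen Gt" and ?s = "gen Gs" and ?s' = "gen Gsbar"
    have t: "- (of_bool (l = ?j) * ?t) \<in> S_filt n 1"
      by (intro S.filt_uminus S.filt_left gen_Gt_S_filt)
    have t': "of_bool (l = ?p) * ?s' * ?t * ?t + of_bool (l = ?j) * ?s' * ?t * ?s \<in> S_filt n 1"
      by (intro S.filt_add S.filt_left gen_Gt_S_filt S.filt_right[OF S.filt_left])
    consider "\<gamma> (Inf (a i)) \<notin> Vflat"
      | "\<gamma> (Inf (a i)) \<in> Vflat" "positively_oriented (velocity \<gamma> (Sup (a ?j))) (velocity \<gamma> (Inf (a i)))"
      | "\<gamma> (Inf (a i)) \<in> Vflat" "\<not> positively_oriented (velocity \<gamma> (Sup (a ?j))) (velocity \<gamma> (Inf (a i)))"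
      by blast
    then show ?thesis
    proof cases
      case 1
      then have "coloring_matrix n \<gamma> Vflat k a i l = S_class n (of_bool (l = i) - of_bool (l = ?p) * c i)"
        by (simp add: coloring_matrix_def Let_def S_class_ops unit c_def)
      then show ?thesis using S.filt_zero by fastforce
    next
      case 2
      then have "coloring_matrix n \<gamma> Vflat k a i l =
          S_class n (of_bool (l = i) - of_bool (l = ?p) * ?s - of_bool (l = ?j) * ?t)"
        by (simp add: coloring_matrix_def Let_def S_class_ops unit S_s_def S_t_def)
      then show ?thesis using 2 t
        by (intro exI[of _ "of_bool (l = i) - of_bool (l = ?p) * ?s - of_bool (l = ?j) * ?t"])
          (simp add: c_def algebra_simps)
    next
      case 3
      then have "coloring_matrix n \<gamma> Vflat k a i l =
          S_class n (of_bool (l = i) - of_bool (l = ?p) * (?s' * (1 - ?t * ?t)) + of_bool (l = ?j) * (?s' * ?t * ?s))"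
        by (simp add: coloring_matrix_def Let_def S_class_ops unit S_s_def S_t_def S_sinv_def)
      then show ?thesis using 3 t'
        by (intro exI[of _ "of_bool (l = i) - of_bool (l = ?p) * (?s' * (1 - ?t * ?t)) + of_bool (l = ?j) * (?s' * ?t * ?s)"])
          (simp add: c_def algebra_simps)
    qed
  qed
  then obtain A where "\<And>i l. coloring_matrix n \<gamma> Vflat k a i l = S_class n (A i l) \<and>
      A i l - (of_bool (l = i) - of_bool (l = prev_arc k i) * c i) \<in> S_filt n 1" by metis
  moreover have "S.unit_mod n 1 (c i)" for i
    by (simp add: c_def s_unit_mod S.unit_mod_one del: One_nat_def)
  ultimately show thesis using that by blast
qed

lemma coloring_quasidet_defined: "quasidet_defined (S_ring n) k (coloring_matrix n \<gamma> Vflat k a) k k"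
proof -
  obtain A c where A: "\<And>i l. coloring_matrix n \<gamma> Vflat k a i l = S_class n (A i l)"
    "\<And>i l. A i l - (of_bool (l = i) - of_bool (l = prev_arc k i) * c i) \<in> S_filt n 1"
    by (rule coloring_matrix_first_order) (rule that)
  show ?thesis
  proof (rule quasidet_defined_S_class[OF A(1)])
    fix i l assume il: "i \<in> {1..<k}" "l \<in> {1..<k}" "i \<noteq> Suc l"
    then have "l \<noteq> prev_arc k i" by (auto simp: prev_arc_def)
    then show "A i l - of_bool (i = l) \<in> S_filt n 1" using A(2)[of i l] by (simp add: eq_commute)
  qed
qed

text \<open>The row vector belonging to \<open>B\<close> is transported along \<open>\<sigma>\<close> to a row vector for \<open>A\<close>, whose
  distinguished position is then \<open>\<sigma> k\<close>; the units are \<open>U = z' k\<close> and \<open>W = w\<close>.\<close>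

lemma coloring_quasidet_relabel:
  fixes n k :: nat and \<gamma> :: "real \<Rightarrow> real^2" and Vflat :: "(real^2) set" and a b :: "nat \<Rightarrow> real set"
  defines "A \<equiv> coloring_matrix n \<gamma> Vflat k a" and "B \<equiv> coloring_matrix n \<gamma> Vflat k b"
  assumes k: "k \<ge> 1" and \<sigma>: "bij_betw \<sigma> {1..k} {1..k}"
    and AB: "\<And>i l. i \<in> {1..k} \<Longrightarrow> l \<in> {1..k} \<Longrightarrow> B i l = A (\<sigma> i) (\<sigma> l)"
  shows "\<exists>U\<in>Units (S_ring n). \<exists>W\<in>Units (S_ring n).
    S_pi0 n (U \<otimes>\<^bsub>S_ring n\<^esub> W) = \<one>\<^bsub>S_ring 0\<^esub> \<and>
    quasidet (S_ring n) k B k k = U \<otimes>\<^bsub>S_ring n\<^esub> quasidet (S_ring n) k A k k \<otimes>\<^bsub>S_ring n\<^esub> W"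
proof -
  let ?I = "{1..k}" and ?J = "S_filt n (Suc n)"
  obtain A' c where A': "\<And>i l. A i l = S_class n (A' i l)"
      "\<And>i l. A' i l - (of_bool (l = i) - of_bool (l = prev_arc k i) * c i) \<in> S_filt n 1"
      and c: "\<And>i. S.unit_mod n 1 (c i)"
    by (rule coloring_matrix_first_order[of n \<gamma> Vflat k a, folded A_def]) (rule that)
  have A'': "A' i l - (of_bool (l = i) - of_bool (l = prev_arc k i) * c i) \<in> S_filt n 1"
    if "i \<in> ?I" "l \<in> ?I" for i l by (rule A'(2))
  have c': "S.unit_mod n 1 (c i)" if "i \<in> ?I" for i by (rule c)
  obtain x v where x: "quasidet (S_ring n) k A k k = S_class n x"
    and v: "v k = 1" "\<And>i. i \<in> ?I \<Longrightarrow> (\<Sum>l\<in>?I. A' i l * v l) - of_bool (i = k) * x \<in> ?J"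
    by (rule quasidet_S_class_vectors[OF k coloring_quasidet_defined[of n k \<gamma> Vflat a, folded A_def]])
      (rule A'(1), rule that)
  have B': "B i l = S_class n (A' (\<sigma> i) (\<sigma> l))" if "i \<in> ?I" "l \<in> ?I" for i l
    using AB[OF that] A'(1) by simp
  obtain y z where y: "quasidet (S_ring n) k B k k = S_class n y"
    and z: "z k = 1" "\<And>l. l \<in> ?I \<Longrightarrow> (\<Sum>i\<in>?I. z i * A' (\<sigma> i) (\<sigma> l)) - of_bool (l = k) * y \<in> ?J"
    by (rule quasidet_S_class_vectors[OF k coloring_quasidet_defined[of n k \<gamma> Vflat b, folded B_def]])
      (rule B', assumption, assumption, rule that)
  define m where "m = \<sigma> k"
  define z' where "z' = z \<circ> inv_into ?I \<sigma>"
  have inv: "inv_into ?I \<sigma> (\<sigma> i) = i" if "i \<in> ?I" for i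
    using \<sigma> that by (simp add: bij_betw_def)
  have m: "m \<in> ?I" using bij_betw_apply[OF \<sigma>, of k] k by (simp add: m_def)
  have z'm: "z' m = 1" using k z(1) inv by (simp add: z'_def m_def)
  have z': "(\<Sum>i\<in>?I. z' i * A' i l) - of_bool (l = m) * y \<in> ?J" if "l \<in> ?I" for l
  proof -
    obtain l' where l': "l' \<in> ?I" "l = \<sigma> l'"
      using bij_betw_imp_surj_on[OF \<sigma>] \<open>l \<in> ?I\<close> by blast
    have "l = m \<longleftrightarrow> l' = k"
      using inj_on_eq_iff[OF bij_betw_imp_inj_on[OF \<sigma>] l'(1), of k] k l'(2) by (simp add: m_def)
    moreover have "(\<Sum>i\<in>?I. z' i * A' i l) = (\<Sum>i\<in>?I. z' (\<sigma> i) * A' (\<sigma> i) l)"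
      by (rule sum.reindex_bij_betw[OF \<sigma>, symmetric])
    moreover have "\<dots> = (\<Sum>i\<in>?I. z i * A' (\<sigma> i) (\<sigma> l'))"
      by (rule sum.cong) (simp_all add: z'_def inv l' del: One_nat_def)
    ultimately show ?thesis using z(2)[OF l'(1)] by simp
  qed
  have "1 \<le> Suc n" by simp
  note comp = S.quasidet_comparison[where n = n, OF this m A'' c' v z'm z']
  obtain w where w: "v m * w - 1 \<in> ?J" "w * v m - 1 \<in> ?J"
    using S.unit_mod_lift[OF comp(3)] unfolding S.unit_mod_def by blast
  have "S.unit_mod n 1 (z' k)"
    by (rule S.unit_mod_cong[OF comp(3) S.filt_sym[OF comp(2)]])
  then obtain u where u: "z' k * u - 1 \<in> ?J" "u * z' k - 1 \<in> ?J"
    using S.unit_mod_lift[of n "z' k" "Suc n"] unfolding S.unit_mod_def by blast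
  have "?J \<subseteq> S_filt n 1" using S.filt_antimono[of 1 "Suc n" n] by simp
  then have "(z' k - v m) * w + (v m * w - 1) \<in> S_filt n 1"
    using comp(2) w(1) by (blast intro: S.filt_add S.filt_right)
  then have "z' k * w - 1 \<in> S_filt 0 (Suc 0)"
    using S_filt_1_subset[of n] S_filt_top[of 0] by (auto simp: algebra_simps)
  then have "S_class 0 (z' k * w) = S_class 0 1" by (simp add: S_class_eq_iff)
  then have pi: "S_pi0 n (S_class n (z' k) \<otimes>\<^bsub>S_ring n\<^esub> S_class n w) = \<one>\<^bsub>S_ring 0\<^esub>"
    by (simp add: S_class_ops S_pi0_class)
  have "- (y * (v m * w - 1)) - (z' k * x - y * v m) * w \<in> ?J"
    using comp(1) w(1) by (blast intro: S.filt_diff S.filt_uminus S.filt_left S.filt_right)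
  then have "y - z' k * x * w \<in> ?J" by (simp add: algebra_simps)
  then have "quasidet (S_ring n) k B k k =
      S_class n (z' k) \<otimes>\<^bsub>S_ring n\<^esub> quasidet (S_ring n) k A k k \<otimes>\<^bsub>S_ring n\<^esub> S_class n w"
    by (simp add: x y S_class_ops S_class_eq_iff)
  with pi show ?thesis using S_class_Units[OF u] S_class_Units[OF w(2,1)] by blast
qed


section \<open>Arcs as gaps of a periodic set\<close>

lemma periodic_Ints:
  fixes \<gamma> :: "real \<Rightarrow> 'a"
  assumes per: "\<And>\<theta>. \<gamma> (\<theta> + 1) = \<gamma> \<theta>" and "x - y \<in> \<int>"
  shows "\<gamma> x = \<gamma> y"
proof -
  have nat: "\<gamma> (\<theta> + real m) = \<gamma> \<theta>" for \<theta> m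
    by (induction m) (use per in \<open>simp_all flip: add.assoc add: add.commute[of 1]\<close>)
  obtain z where z: "x = y + of_int z" using assms(2) by (auto elim!: Ints_cases simp: algebra_simps)
  show ?thesis
  proof (cases "z \<ge> 0")
    case True
    then show ?thesis using nat[of y "nat z"] z by simp
  next
    case False
    then show ?thesis using nat[of x "nat (- z)"] z by simp
  qed
qed

lemma velocity_Ints:
  assumes "immersed_circle \<gamma>" "x - y \<in> \<int>"
  shows "velocity \<gamma> x = velocity \<gamma> y"
proof -
  have per: "\<gamma> (\<theta> + 1) = \<gamma> \<theta>" for \<theta> using assms by (auto simp: immersed_circle_def)
  obtain D where D: "(\<gamma> has_vector_derivative D) (at y)"
    using assms unfolding immersed_circle_def C1_differentiable_on_def by auto
  have "((\<lambda>\<theta>. \<theta> + (y - x)) has_vector_derivative 1) (at x)"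
    by (auto intro!: derivative_eq_intros simp: has_real_derivative_iff_has_vector_derivative[symmetric])
  moreover have "\<gamma> \<circ> (\<lambda>\<theta>. \<theta> + (y - x)) = \<gamma>"
  proof
    have "y - x \<in> \<int>" using Ints_minus[OF assms(2)] by simp
    then show "(\<gamma> \<circ> (\<lambda>\<theta>. \<theta> + (y - x))) \<theta> = \<gamma> \<theta>" for \<theta>
      by (simp add: periodic_Ints[where \<gamma> = \<gamma>, OF per, of "\<theta> + (y - x)" \<theta>])
  qed
  ultimately have "(\<gamma> has_vector_derivative D) (at x)"
    using vector_diff_chain_at[of "\<lambda>\<theta>. \<theta> + (y - x)" 1 x \<gamma> D] D by simp
  then show ?thesis using D by (simp add: velocity_def vector_derivative_at)
qed

text \<open>The combinatorics of arcs takes place on the real line: an arc is recorded by the end points of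
  one of its lifts, an interval between consecutive parameters of vertices.\<close>

definition gap :: "(real \<Rightarrow> 'a) \<Rightarrow> 'a set \<Rightarrow> real \<Rightarrow> real \<Rightarrow> bool" where
  "gap \<gamma> V l r \<longleftrightarrow> l < r \<and> \<gamma> l \<in> V \<and> \<gamma> r \<in> V \<and> (\<forall>\<theta>\<in>{l<..<r}. \<gamma> \<theta> \<notin> V)"

lemma gap_unique_right: "gap \<gamma> V l r \<Longrightarrow> gap \<gamma> V l r' \<Longrightarrow> r = r'"
  by (rule linorder_cases[of r r']) (auto simp: gap_def)

lemma gap_unique_left: "gap \<gamma> V l r \<Longrightarrow> gap \<gamma> V l' r \<Longrightarrow> l = l'"
  by (rule linorder_cases[of l l']) (auto simp: gap_def)

lemma gap_shift:
  assumes per: "\<And>\<theta>. \<gamma> (\<theta> + 1) = \<gamma> \<theta>" and "m \<in> \<int>" "gap \<gamma> V l r"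
  shows "gap \<gamma> V (l + m) (r + m)"
proof -
  have shift: "\<gamma> (\<theta> + m) = \<gamma> \<theta>" "\<gamma> (\<theta> - m) = \<gamma> \<theta>" for \<theta>
    using assms(2) by (auto intro!: periodic_Ints[where \<gamma> = \<gamma>, OF per])
  have "\<gamma> \<theta> \<notin> V" if "\<theta> \<in> {l + m<..<r + m}" for \<theta>
    using assms(3) that shift(2)[of \<theta>] by (auto simp: gap_def dest!: bspec[of _ _ "\<theta> - m"])
  then show ?thesis using assms(3) shift by (simp add: gap_def)
qed

text \<open>The parameter \<open>\<theta>\<^sub>0\<close> of a vertex and its integer translates confine each component to an interval of length one;
  its end points are parameters of vertices, since otherwise the component could be enlarged.\<close>

lemma component_gap:
  fixes \<gamma> :: "real \<Rightarrow> 'a::t2_space"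
  assumes per: "\<And>\<theta>. \<gamma> (\<theta> + 1) = \<gamma> \<theta>" and cont: "continuous_on UNIV \<gamma>"
    and V: "closed V" "\<gamma> \<theta>\<^sub>0 \<in> V" and C: "C \<in> components {\<theta>. \<gamma> \<theta> \<notin> V}"
  shows "gap \<gamma> V (Inf C) (Sup C)"
proof -
  let ?U = "{\<theta>. \<gamma> \<theta> \<notin> V}"
  have "?U = \<gamma> -` (- V)" by auto
  then have "open ?U" using cont V(1) by (simp add: open_vimage open_Compl)
  then have op: "open C" using C by (rule open_components)
  have conn: "connected C" and sub: "C \<subseteq> ?U" and "C \<noteq> {}"
    using C by (auto simp: in_components_connected dest: in_components_subset in_components_nonempty)
  then obtain x where x: "x \<in> C" by blast
  \<comment> \<open>the last translate of \<open>\<theta>\<^sub>0\<close> that is not beyond \<open>x\<close>\<close>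
  define p where "p = \<theta>\<^sub>0 + of_int \<lfloor>x - \<theta>\<^sub>0\<rfloor>"
  have p: "p \<le> x" "x < p + 1" unfolding p_def by linarith+
  have "\<gamma> p = \<gamma> \<theta>\<^sub>0" "\<gamma> (p + 1) = \<gamma> p"
    by (auto simp: p_def per intro!: periodic_Ints[where \<gamma> = \<gamma>, OF per])
  then have pC: "p \<notin> C" "p + 1 \<notin> C" using V(2) sub by auto
  have bd: "p < y \<and> y < p + 1" if "y \<in> C" for y
    using connected_contains_Icc[OF conn that x] connected_contains_Icc[OF conn x that] p pC
    by (meson atLeastAtMost_iff in_mono leI order_less_imp_le)
  have bdd: "bdd_below C" "bdd_above C"
    using bd by (auto intro!: bdd_belowI[of _ p] bdd_aboveI[of _ "p + 1"] less_imp_le)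
  have notin: "Inf C \<notin> C" "Sup C \<notin> C"
    using Inf_notin_open[OF op, of p] Sup_notin_open[OF op, of "p + 1"] bd by auto
  then have x2: "Inf C < x" "x < Sup C"
    using cInf_lower[OF x bdd(1)] cSup_upper[OF x bdd(2)] x by (auto simp: less_le)
  have int: "y \<in> C" if y: "Inf C < y" "y < Sup C" for y
  proof -
    obtain u v where "u \<in> C" "u < y" "v \<in> C" "y < v"
      using y cInf_less_iff[OF \<open>C \<noteq> {}\<close> bdd(1)] less_cSup_iff[OF \<open>C \<noteq> {}\<close> bdd(2)] by blast
    then show ?thesis using connected_contains_Icc[OF conn, of u v] by auto
  qed
  have "\<gamma> (Inf C) \<in> V"
  proof (rule ccontr)
    assume *: "\<gamma> (Inf C) \<notin> V"
    have "{Inf C..x} \<subseteq> ?U"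
    proof
      fix y assume "y \<in> {Inf C..x}"
      then have "y = Inf C \<or> y \<in> C" using int[of y] x2 by force
      then show "y \<in> ?U" using * sub by auto
    qed
    moreover have "C \<inter> {Inf C..x} \<noteq> {}" using x x2 by auto
    ultimately have "{Inf C..x} \<subseteq> C" using components_maximal[OF C, of "{Inf C..x}"] by simp
    moreover have "Inf C \<in> {Inf C..x}" using x2 by simp
    ultimately show False using notin by blast
  qed
  moreover have "\<gamma> (Sup C) \<in> V"
  proof (rule ccontr)
    assume *: "\<gamma> (Sup C) \<notin> V"
    have "{x..Sup C} \<subseteq> ?U"
    proof
      fix y assume "y \<in> {x..Sup C}"
      then have "y = Sup C \<or> y \<in> C" using int[of y] x2 by force
      then show "y \<in> ?U" using * sub by auto
    qed
    moreover have "C \<inter> {x..Sup C} \<noteq> {}" using x x2 by auto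
    ultimately have "{x..Sup C} \<subseteq> C" using components_maximal[OF C, of "{x..Sup C}"] by simp
    moreover have "Sup C \<in> {x..Sup C}" using x2 by simp
    ultimately show False using notin by blast
  qed
  moreover have "\<gamma> \<theta> \<notin> V" if "\<theta> \<in> {Inf C<..<Sup C}" for \<theta>
    using that int[of \<theta>] sub by auto
  ultimately show ?thesis using x2 by (simp add: gap_def)
qed

text \<open>The \<open>k\<close> gaps tile one period, so modulo \<open>\<int>\<close> every vertex parameter is the initial point of
  exactly one of them, and the terminal point of exactly one of them.\<close>

locale cyclic_gaps =
  fixes \<gamma> :: "real \<Rightarrow> 'a" and V :: "'a set" and k :: nat and lo hi :: "nat \<Rightarrow> real"
  assumes per: "\<And>\<theta>. \<gamma> (\<theta> + 1) = \<gamma> \<theta>"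
    and k: "k \<ge> 1"
    and gap: "i \<in> {1..k} \<Longrightarrow> gap \<gamma> V (lo i) (hi i)"
    and step: "i \<in> {1..<k} \<Longrightarrow> hi i = lo (Suc i)"
    and turn: "hi k = lo 1 + 1"
begin

lemma lo_less_hi: "i \<in> {1..k} \<Longrightarrow> lo i < hi i"
  using gap by (simp add: gap_def)

lemma hi_le_lo: "i < j \<Longrightarrow> 1 \<le> i \<Longrightarrow> j \<le> k \<Longrightarrow> hi i \<le> lo j"
proof (induction j rule: less_Suc_induct[of i, consumes 1, case_names step trans])
  case (step i)
  then show ?case using cyclic_gaps.step[OF cyclic_gaps_axioms, of i] by simp
next
  case (trans i j l)
  then show ?case using lo_less_hi[of j] by fastforce
qed

lemma lo_inj:
  assumes "i \<in> {1..k}" "j \<in> {1..k}" "lo i - lo j \<in> \<int>"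
  shows "i = j"
proof -
  have bound: "lo 1 \<le> lo l" "hi l \<le> lo 1 + 1" if "l \<in> {1..k}" for l
    using hi_le_lo[of 1 l] hi_le_lo[of l k] lo_less_hi[of 1] lo_less_hi[of k] turn k that
    by (cases "l = 1"; cases "l = k"; force)+
  have less: "lo j - lo i \<notin> \<int>" if "i \<in> {1..k}" "j \<in> {1..k}" "i < j" for i j
  proof
    assume "lo j - lo i \<in> \<int>"
    moreover have "0 < lo j - lo i" "lo j - lo i < 1"
      using hi_le_lo[of i j] lo_less_hi[of i] lo_less_hi[of j] bound(1)[of i] bound(2)[of j] that by auto
    ultimately show False by (auto elim!: Ints_cases)
  qed
  show ?thesis
    using less[of i j] less[of j i] assms Ints_minus[OF assms(3)]
    by (cases i j rule: linorder_cases) auto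
qed

lemma lo_surj:
  assumes "\<gamma> \<theta> \<in> V"
  obtains i where "i \<in> {1..k}" "\<theta> - lo i \<in> \<int>"
proof -
  define \<theta>' where "\<theta>' = \<theta> - of_int \<lfloor>\<theta> - lo 1\<rfloor>"
  have \<theta>': "lo 1 \<le> \<theta>'" "\<theta>' < hi k" unfolding \<theta>'_def turn by linarith+
  have "\<theta>' - \<theta> \<in> \<int>" by (simp add: \<theta>'_def)
  then have in_V: "\<gamma> \<theta>' \<in> V" using periodic_Ints[where \<gamma> = \<gamma>, OF per, of \<theta>' \<theta>] assms by simp
  have at_lo: "\<theta>' = lo i" if "i \<in> {1..k}" "lo i \<le> \<theta>'" "\<theta>' < hi i" for i
    using gap[OF that(1)] that in_V by (force simp: gap_def)
  have "\<exists>j\<in>{1..k}. \<theta>' = lo j" if "i \<ge> 1" "i \<le> k" "\<theta>' < hi i" for i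
    using that
  proof (induction i rule: nat_induct_at_least)
    case base
    then show ?case using at_lo[of 1] \<theta>' by auto
  next
    case (Suc i)
    then show ?case using at_lo[of "Suc i"] step[of i] by force
  qed
  then obtain j where "j \<in> {1..k}" "\<theta>' = lo j" using \<theta>' k by blast
  then show thesis using that[of j] Ints_minus[OF \<open>\<theta>' - \<theta> \<in> \<int>\<close>] by simp
qed

lemma hi_prev:
  assumes "i \<in> {1..k}"
  shows "hi (prev_arc k i) - lo i \<in> \<int>"
proof (cases "i = 1")
  case True
  then show ?thesis using turn by (simp add: prev_arc_def)
next
  case False
  then show ?thesis using step[of "i - 1"] assms by (simp add: prev_arc_def) force
qed

lemma hi_inj:
  assumes ij: "i \<in> {1..k}" "j \<in> {1..k}" "hi i - hi j \<in> \<int>"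
  shows "i = j"
proof -
  have "gap \<gamma> V (lo j + (hi i - hi j)) (hi i)"
    using gap_shift[where \<gamma> = \<gamma>, OF per ij(3) gap[OF ij(2)]] by simp
  then have "lo i = lo j + (hi i - hi j)" by (rule gap_unique_left[OF gap[OF ij(1)]])
  then show ?thesis using lo_inj[OF ij(1,2)] ij(3) by simp
qed

end

text \<open>Gap \<open>i\<close> of the second tiling starts, modulo \<open>\<int>\<close>, where a unique gap \<open>\<sigma> i\<close> of the first one does.
  A gap is determined by either end point, so the two are translates of each other, and \<open>\<sigma>\<close> respects the cyclic
  order because a gap ends where the next one starts.\<close>

lemma cyclic_gaps_relabel:
  assumes "cyclic_gaps \<gamma> V k lo hi" "cyclic_gaps \<gamma> V k lo' hi'"
  obtains \<sigma> where "bij_betw \<sigma> {1..k} {1..k}"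
    "\<And>i. i \<in> {1..k} \<Longrightarrow> lo' i - lo (\<sigma> i) \<in> \<int>"
    "\<And>i. i \<in> {1..k} \<Longrightarrow> hi' i - hi (\<sigma> i) \<in> \<int>"
    "\<And>i. i \<in> {1..k} \<Longrightarrow> \<sigma> (prev_arc k i) = prev_arc k (\<sigma> i)"
proof -
  interpret A: cyclic_gaps \<gamma> V k lo hi by fact
  interpret B: cyclic_gaps \<gamma> V k lo' hi' by fact
  have "\<exists>j. j \<in> {1..k} \<and> lo' i - lo j \<in> \<int>" if "i \<in> {1..k}" for i
  proof -
    have "\<gamma> (lo' i) \<in> V" using B.gap[OF that] by (simp add: gap_def)
    then show ?thesis by (rule A.lo_surj) blast
  qed
  then obtain \<sigma> where \<sigma>: "\<And>i. i \<in> {1..k} \<Longrightarrow> \<sigma> i \<in> {1..k} \<and> lo' i - lo (\<sigma> i) \<in> \<int>" by metis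
  have hi: "hi' i - hi (\<sigma> i) \<in> \<int>" if i: "i \<in> {1..k}" for i
  proof -
    have "gap \<gamma> V (lo' i) (hi (\<sigma> i) + (lo' i - lo (\<sigma> i)))"
      using gap_shift[where \<gamma> = \<gamma>, OF A.per conjunct2[OF \<sigma>[OF i]] A.gap[of "\<sigma> i"]] \<sigma>[OF i] by simp
    then have "hi' i = hi (\<sigma> i) + (lo' i - lo (\<sigma> i))" by (rule gap_unique_right[OF B.gap[OF i]])
    then show ?thesis using \<sigma>[OF i] by simp
  qed
  have "inj_on \<sigma> {1..k}"
  proof (rule inj_onI)
    fix i j assume ij: "i \<in> {1..k}" "j \<in> {1..k}" "\<sigma> i = \<sigma> j"
    then have "(lo' i - lo (\<sigma> i)) - (lo' j - lo (\<sigma> j)) \<in> \<int>" using \<sigma> by (blast intro: Ints_diff)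
    then show "i = j" using B.lo_inj ij by simp
  qed
  then have bij: "bij_betw \<sigma> {1..k} {1..k}"
    using endo_inj_surj[of "{1..k}" \<sigma>] \<sigma> by (simp add: bij_betw_def image_subset_iff)
  have "\<sigma> (prev_arc k i) = prev_arc k (\<sigma> i)" if i: "i \<in> {1..k}" for i
  proof (rule A.hi_inj)
    have prev: "prev_arc k j \<in> {1..k}" if "j \<in> {1..k}" for j using that by (auto simp: prev_arc_def)
    show "\<sigma> (prev_arc k i) \<in> {1..k}" "prev_arc k (\<sigma> i) \<in> {1..k}" using \<sigma> i prev by blast+
    have "(hi' (prev_arc k i) - lo' i) - (hi' (prev_arc k i) - hi (\<sigma> (prev_arc k i)))
        + (lo' i - lo (\<sigma> i)) - (hi (prev_arc k (\<sigma> i)) - lo (\<sigma> i)) \<in> \<int>"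
      using B.hi_prev[OF i] hi[OF prev[OF i]] \<sigma>[OF i] A.hi_prev[of "\<sigma> i"] by (blast intro: Ints_diff Ints_add)
    then show "hi (\<sigma> (prev_arc k i)) - hi (prev_arc k (\<sigma> i)) \<in> \<int>" by simp
  qed
  with bij \<sigma> hi show thesis using that by blast
qed


section \<open>Relabelling the arcs of a diagram\<close>

lemma arc_labelling_gaps:
  assumes D: "flat_virtual_knot_diagram \<gamma> Vflat" "fake_vertices \<gamma> Vfake" "Vflat \<union> Vfake \<noteq> {}"
    and a: "arc_labelling \<gamma> (Vflat \<union> Vfake) k a"
  shows "cyclic_gaps \<gamma> (Vflat \<union> Vfake) k (\<lambda>i. Inf (a i)) (\<lambda>i. Sup (a i))"
proof -
  let ?V = "Vflat \<union> Vfake"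
  have per: "\<gamma> (\<theta> + 1) = \<gamma> \<theta>" for \<theta>
    using D(1) by (auto simp: flat_virtual_knot_diagram_def generic_immersion_def immersed_circle_def)
  have C1: "\<gamma> C1_differentiable_on UNIV"
    and fin: "finite (multiple_points \<gamma>)" and sub: "Vflat \<subseteq> multiple_points \<gamma>"
    using D(1) by (auto simp: flat_virtual_knot_diagram_def generic_immersion_def immersed_circle_def)
  have "finite ?V" using fin sub D(2) by (auto simp: fake_vertices_def intro: finite_subset)
  then have closed: "closed ?V" by (rule finite_imp_closed)
  have "?V \<subseteq> range \<gamma>" using sub D(2) by (auto simp: fake_vertices_def multiple_points_def)
  then obtain \<theta>\<^sub>0 where \<theta>\<^sub>0: "\<gamma> \<theta>\<^sub>0 \<in> ?V" using D(3) by blast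
  have cont: "continuous_on UNIV \<gamma>"
    using C1 by (rule C1_differentiable_imp_continuous_on)
  show ?thesis
  proof
    show "gap \<gamma> ?V (Inf (a i)) (Sup (a i))" if "i \<in> {1..k}" for i
      using a that component_gap[OF per cont closed \<theta>\<^sub>0] by (auto simp: arc_labelling_def)
  qed (use a per in \<open>auto simp: arc_labelling_def\<close>)
qed

text \<open>A double point has exactly two parameters modulo \<open>\<int>\<close>, and one of them is \<open>\<theta>\<close>; the arc is the one that
  ends at the other. With this, the description defining the entering arc commutes with
  relabelling.\<close>

lemma entering_arc_ex1:
  assumes D: "generic_immersion \<gamma>" and gaps: "cyclic_gaps \<gamma> V k lo hi"
    and x: "\<gamma> \<theta> \<in> V" "\<gamma> \<theta> \<in> multiple_points \<gamma>"
  shows "\<exists>!j. j \<in> {1..k} \<and> \<gamma> (hi j) = \<gamma> \<theta> \<and> hi j - \<theta> \<notin> \<int>"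
proof -
  interpret cyclic_gaps \<gamma> V k lo hi by fact
  let ?F = "{\<phi>\<in>{0..<1}. \<gamma> \<phi> = \<gamma> \<theta>}"
  have card: "card ?F = 2" using D x(2) by (auto simp: generic_immersion_def)
  have frac: "frac \<phi> \<in> ?F" if "\<gamma> \<phi> = \<gamma> \<theta>" for \<phi>
    using that frac_lt_1[of \<phi>] periodic_Ints[where \<gamma> = \<gamma>, OF per, of "frac \<phi>" \<phi>] by (simp add: frac_def)
  have frac_eq: "\<phi> - \<psi> \<in> \<int>" if "frac \<phi> = frac \<psi>" for \<phi> \<psi> :: real
  proof -
    have "\<phi> - \<psi> = of_int (\<lfloor>\<phi>\<rfloor> - \<lfloor>\<psi>\<rfloor>)" using that by (simp add: frac_def)
    then show ?thesis by simp
  qed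
  show ?thesis
  proof (rule ex_ex1I)
    obtain \<phi> \<psi> where "\<phi> - \<psi> \<notin> \<int>" "\<gamma> \<phi> = \<gamma> \<theta>" "\<gamma> \<psi> = \<gamma> \<theta>"
      using x(2) by (auto simp: multiple_points_def)
    then obtain \<phi> where \<phi>: "\<gamma> \<phi> = \<gamma> \<theta>" "\<phi> - \<theta> \<notin> \<int>"
      using Ints_diff[of "\<phi> - \<theta>" "\<psi> - \<theta>"] by auto
    then obtain i where i: "i \<in> {1..k}" "\<phi> - lo i \<in> \<int>" using lo_surj[of \<phi>] x(1) by metis
    let ?j = "prev_arc k i"
    have j: "?j \<in> {1..k}" using i by (auto simp: prev_arc_def)
    have "(\<phi> - lo i) - (hi ?j - lo i) \<in> \<int>" using i hi_prev[OF i(1)] by (blast intro: Ints_diff)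
    then have j\<phi>: "\<phi> - hi ?j \<in> \<int>" by simp
    then have "\<gamma> (hi ?j) = \<gamma> \<theta>" using periodic_Ints[where \<gamma> = \<gamma>, OF per j\<phi>] \<phi> by simp
    moreover have "hi ?j - \<theta> \<notin> \<int>" using \<phi>(2) Ints_add[OF j\<phi>, of "hi ?j - \<theta>"] by auto
    ultimately show "\<exists>j. j \<in> {1..k} \<and> \<gamma> (hi j) = \<gamma> \<theta> \<and> hi j - \<theta> \<notin> \<int>" using j by blast
  next
    fix i j assume i: "i \<in> {1..k} \<and> \<gamma> (hi i) = \<gamma> \<theta> \<and> hi i - \<theta> \<notin> \<int>"
      and j: "j \<in> {1..k} \<and> \<gamma> (hi j) = \<gamma> \<theta> \<and> hi j - \<theta> \<notin> \<int>"
    have "finite ?F" using card by (simp add: card_ge_0_finite)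
    then have "card {frac \<theta>, frac (hi i), frac (hi j)} \<le> 2"
      using card_mono[of ?F "{frac \<theta>, frac (hi i), frac (hi j)}"] card frac i j by auto
    moreover have "frac (hi i) \<noteq> frac \<theta>" "frac (hi j) \<noteq> frac \<theta>" using i j frac_eq by blast+
    ultimately have "frac (hi i) = frac (hi j)" by (auto simp: card_insert_if split: if_splits)
    then show "i = j" using hi_inj i j frac_eq by blast
  qed
qed

lemma coloring_matrix_relabel:
  assumes D: "flat_virtual_knot_diagram \<gamma> Vflat" "fake_vertices \<gamma> Vfake" "Vflat \<union> Vfake \<noteq> {}"
    and a: "arc_labelling \<gamma> (Vflat \<union> Vfake) k a"
    and b: "arc_labelling \<gamma> (Vflat \<union> Vfake) k b"
  obtains \<sigma> where "bij_betw \<sigma> {1..k} {1..k}"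
    and "\<And>i l. i \<in> {1..k} \<Longrightarrow> l \<in> {1..k} \<Longrightarrow>
      coloring_matrix n \<gamma> Vflat k b i l = coloring_matrix n \<gamma> Vflat k a (\<sigma> i) (\<sigma> l)"
proof -
  let ?V = "Vflat \<union> Vfake"
  note A = arc_labelling_gaps[OF D a] and B = arc_labelling_gaps[OF D b]
  have gen: "generic_immersion \<gamma>" and imm: "immersed_circle \<gamma>" and per: "\<gamma> (\<theta> + 1) = \<gamma> \<theta>"
    and sub: "Vflat \<subseteq> multiple_points \<gamma>" for \<theta>
    using D(1) by (auto simp: flat_virtual_knot_diagram_def generic_immersion_def immersed_circle_def)
  obtain \<sigma> where \<sigma>: "bij_betw \<sigma> {1..k} {1..k}"
    and lo: "\<And>i. i \<in> {1..k} \<Longrightarrow> Inf (b i) - Inf (a (\<sigma> i)) \<in> \<int>"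
    and hi: "\<And>i. i \<in> {1..k} \<Longrightarrow> Sup (b i) - Sup (a (\<sigma> i)) \<in> \<int>"
    and prev: "\<And>i. i \<in> {1..k} \<Longrightarrow> \<sigma> (prev_arc k i) = prev_arc k (\<sigma> i)"
    by (rule cyclic_gaps_relabel[OF A B]) (rule that)
  have mem: "\<sigma> i \<in> {1..k}" if "i \<in> {1..k}" for i
    using \<sigma> that by (rule bij_betw_apply)
  have inj: "\<sigma> i = \<sigma> j \<longleftrightarrow> i = j" if "i \<in> {1..k}" "j \<in> {1..k}" for i j
    using bij_betw_imp_inj_on[OF \<sigma>] that by (rule inj_on_eq_iff)
  note g = periodic_Ints[where \<gamma> = \<gamma>, OF per]
  have enter: "entering_arc \<gamma> k b i \<in> {1..k}" "entering_arc \<gamma> k a (\<sigma> i) = \<sigma> (entering_arc \<gamma> k b i)"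
    if i: "i \<in> {1..k}" and flat: "\<gamma> (Inf (b i)) \<in> Vflat" for i
  proof -
    let ?j = "entering_arc \<gamma> k b i"
    have ex1: "\<exists>!j. j \<in> {1..k} \<and> \<gamma> (Sup (b j)) = \<gamma> (Inf (b i)) \<and> Sup (b j) - Inf (b i) \<notin> \<int>"
      using entering_arc_ex1[OF gen B] flat sub by blast
    have j: "?j \<in> {1..k}" "\<gamma> (Sup (b ?j)) = \<gamma> (Inf (b i))" "Sup (b ?j) - Inf (b i) \<notin> \<int>"
      using theI'[OF ex1] unfolding entering_arc_def by blast+
    show "?j \<in> {1..k}" by (fact j)
    have ex1': "\<exists>!j. j \<in> {1..k} \<and> \<gamma> (Sup (a j)) = \<gamma> (Inf (a (\<sigma> i))) \<and> Sup (a j) - Inf (a (\<sigma> i)) \<notin> \<int>"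
      using entering_arc_ex1[OF gen A, of "Inf (a (\<sigma> i))"] flat sub g[OF lo[OF i]] by auto
    have "Sup (a (\<sigma> ?j)) - Inf (a (\<sigma> i)) \<notin> \<int>"
    proof
      assume "Sup (a (\<sigma> ?j)) - Inf (a (\<sigma> i)) \<in> \<int>"
      then have "Sup (a (\<sigma> ?j)) - Inf (a (\<sigma> i)) + (Sup (b ?j) - Sup (a (\<sigma> ?j))) - (Inf (b i) - Inf (a (\<sigma> i))) \<in> \<int>"
        using hi[OF j(1)] lo[OF i] by (blast intro: Ints_diff Ints_add)
      then show False using j(3) by simp
    qed
    then show "entering_arc \<gamma> k a (\<sigma> i) = \<sigma> ?j"
      unfolding entering_arc_def[of \<gamma> k a] using j(1,2) mem g[OF lo[OF i]] g[OF hi[OF j(1)]]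
      by (intro the1_equality[OF ex1']) auto
  qed
  have "coloring_matrix n \<gamma> Vflat k b i l = coloring_matrix n \<gamma> Vflat k a (\<sigma> i) (\<sigma> l)"
    if i: "i \<in> {1..k}" and l: "l \<in> {1..k}" for i l
  proof -
    have p: "prev_arc k i \<in> {1..k}" using i by (auto simp: prev_arc_def)
    have unit: "row_unit R x i l = row_unit R x (\<sigma> i) (\<sigma> l)"
      "row_unit R x (prev_arc k i) l = row_unit R x (prev_arc k (\<sigma> i)) (\<sigma> l)" for R :: "free set ring" and x
      using inj[OF l i] inj[OF l p] prev[OF i] by (simp_all add: row_unit_def)
    show ?thesis
    proof (cases "\<gamma> (Inf (b i)) \<in> Vflat")
      case True
      note e = enter[OF i True]
      have "row_unit R x (entering_arc \<gamma> k b i) l = row_unit R x (entering_arc \<gamma> k a (\<sigma> i)) (\<sigma> l)"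
        for R :: "free set ring" and x
        using inj[OF l e(1)] by (simp add: row_unit_def e(2))
      moreover have "velocity \<gamma> (Sup (b (entering_arc \<gamma> k b i))) = velocity \<gamma> (Sup (a (entering_arc \<gamma> k a (\<sigma> i))))"
        unfolding e(2) by (rule velocity_Ints[OF imm hi[OF e(1)]])
      ultimately show ?thesis
        unfolding coloring_matrix_def Let_def
        by (simp only: unit g[OF lo[OF i]] velocity_Ints[OF imm lo[OF i]])
    next
      case False
      then show ?thesis
        unfolding coloring_matrix_def Let_def
        by (simp only: unit g[OF lo[OF i]] if_False)
    qed
  qed
  with \<sigma> show thesis using that by blast
qed


theorem claim6p2:
  fixes n k :: nat
    and \<gamma> :: "real \<Rightarrow> real^2"
    and Vflat Vfake :: "(real^2) set"
    and a b :: "nat \<Rightarrow> real set"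
    and A B :: "nat \<Rightarrow> nat \<Rightarrow> free set"
  assumes "flat_virtual_knot_diagram \<gamma> Vflat"
    and "fake_vertices \<gamma> Vfake"
    and "Vflat \<union> Vfake \<noteq> {}"
    and "arc_labelling \<gamma> (Vflat \<union> Vfake) k a"
    and "arc_labelling \<gamma> (Vflat \<union> Vfake) k b"
  defines "A \<equiv> coloring_matrix n \<gamma> Vflat k a"
    and "B \<equiv> coloring_matrix n \<gamma> Vflat k b"
  shows "quasidet_defined (S_ring n) k A k k \<and> quasidet_defined (S_ring n) k B k k \<and>
    (\<exists>U\<in>Units (S_ring n). \<exists>W\<in>Units (S_ring n).
      S_pi0 n (U \<otimes>\<^bsub>S_ring n\<^esub> W) = \<one>\<^bsub>S_ring 0\<^esub> \<and>
      quasidet (S_ring n) k B k k =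
        U \<otimes>\<^bsub>S_ring n\<^esub> quasidet (S_ring n) k A k k \<otimes>\<^bsub>S_ring n\<^esub> W)"
proof -
  obtain \<sigma> where "bij_betw \<sigma> {1..k} {1..k}"
    and "\<And>i l. i \<in> {1..k} \<Longrightarrow> l \<in> {1..k} \<Longrightarrow> B i l = A (\<sigma> i) (\<sigma> l)"
    by (rule coloring_matrix_relabel[OF assms(1-5), of n, folded A_def B_def]) (rule that)
  moreover have "k \<ge> 1" using assms(4) by (simp add: arc_labelling_def)
  ultimately show ?thesis
    using coloring_quasidet_relabel[of k \<sigma> n \<gamma> Vflat b a] coloring_quasidet_defined
    unfolding A_def B_def by blast
qed

end
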